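(* Let $p>1+2/n$ and let $m\in\mathbb{Z}_{>0}$. Let $u_0\in L^1_m(\mathbb{R}^n)\cap L^\infty(\mathbb{R}^n)$ and let $u\in X$ be a global solution to (P) satisfying $$\sup_{q\in[1,+\infty]}\ \sup_{t>0}\ t^{\frac n2\left(1-\frac1q\right)}\|u(t)\|_q<+\infty .$$ Then $u\in C([0,+\infty);L^1_m(\mathbb{R}^n))$, and moreover there exists $C>0$ such that $$\sum_{|\alpha|=m}\|x^\alpha u(t)\|_1\le C\left(1+t^{\frac m2}\right)$$ holds for all $t>0$.
   Context: Let $n\in\mathbb{Z}_{>0}$, $\nu\in\mathbb{C}$ with $\operatorname{Re}\nu>0$, and $p\in(1,+\infty)$. Let $f:\mathbb{C}\to\mathbb{C}$ satisfy $f(0)=0$ and, for some $K>0$, $|f(\xi)-f(\eta)|\le K(|\xi|^{p-1}+|\eta|^{p-1})|\xi-\eta|$ for all $\xi,\eta\in\mathbb{C}$. (P) denotes the Cauchy problem $\partial_t u-\nu\Delta u=f(u)$ in $(0,+\infty)\times\mathbb{R}^n$, $u(0)=u_0$ in $\mathbb{R}^n$, for a complex-valued unknown $u$. $L^q(\mathbb{R}^n)$, $q\in[1,+\infty]$, is the complex-valued Lebesgue space with norm $\|\cdot\|_q$. For $\alpha\in\mathbb{Z}_{\ge0}^n$, $|\alpha|=\sum_j\alpha_j$ and $x^\alpha=\prod_j x_j^{\alpha_j}$; $x^\alpha\varphi$ denotes the function $x\mapsto x^\alpha\varphi(x)$. For $m\in\mathbb{Z}_{>0}$, $L^1_m(\mathbb{R}^n)$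 is the set of $\varphi\in L^1(\mathbb{R}^n)$ with $x^\alpha\varphi\in L^1(\mathbb{R}^n)$ for all $|\alpha|\le m$ (with its natural norm $\sum_{|\alpha|\le m}\|x^\alpha\varphi\|_1$). $G_{t\nu}(x)=(4\pi t\nu)^{-n/2}\exp\left(-\frac{|x|^2}{4t\nu}\right)$ (principal branch of the power), and $e^{t\nu\Delta}\varphi=G_{t\nu}*\varphi$ for $t>0$, $e^{0\nu\Delta}\varphi=\varphi$. $X=(C\cap L^\infty)([0,+\infty);L^1(\mathbb{R}^n))\cap(C\cap L^\infty)((0,+\infty);L^\infty(\mathbb{R}^n))$. For $u_0\in L^1(\mathbb{R}^n)\cap L^\infty(\mathbb{R}^n)$, a function $u\in X$ is a global (mild) solution to (P) if $u(t)=e^{t\nu\Delta}u_0+\int_0^t e^{(t-s)\nu\Delta}f(u(s))\,ds$ holds in $L^1(\mathbb{R}^n)\cap L^\infty(\mathbb{R}^n)$ for all $t>0$. *)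

theory Defs
  imports "HOL-Probability.Essential_Supremum"
begin

text \<open>
  Elements of the function spaces over \<open>\<real>\<^sup>n\<close> are handled through representatives: a class of
  functions modulo null sets is given by any Borel function in it (every Lebesgue measurable
  function has one), equality in the space is equality almost everywhere, and the quantities below
  depend only on the class. The dimension is \<open>n = CARD('n)\<close>. Norms take values in
  \<^typ>\<open>ennreal\<close>; a space is a set of functions together with such a norm.
\<close>

type_synonym 'n cfun = "real ^ 'n \<Rightarrow> complex"

definition Lp_norm :: "ennreal \<Rightarrow> ('n::finite) cfun \<Rightarrow> ennreal" where
  "Lp_norm q \<phi> =
     (if q = \<infinity> then esssup lborel (\<lambda>x. ennreal (norm (\<phi> x)))
      else let I = (\<integral>\<^sup>+x. ennreal (norm (\<phi> x) powr enn2real q) \<partial>lborel)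
           in if I = \<infinity> then \<infinity> else ennreal (enn2real I powr (1 / enn2real q)))"

definition Lp :: "ennreal \<Rightarrow> ('n::finite) cfun set" where
  "Lp q = {\<phi> \<in> borel_measurable lborel. Lp_norm q \<phi> < \<infinity>}"

definition L1_Linf_norm :: "('n::finite) cfun \<Rightarrow> ennreal" where
  "L1_Linf_norm \<phi> = Lp_norm 1 \<phi> + Lp_norm \<infinity> \<phi>"


text \<open>Multi-indices are functions \<^typ>\<open>'n \<Rightarrow> nat\<close>.\<close>

definition mi_order :: "('n::finite \<Rightarrow> nat) \<Rightarrow> nat" where
  "mi_order \<alpha> = (\<Sum>j\<in>UNIV. \<alpha> j)"

definition mi_mult :: "('n::finite \<Rightarrow> nat) \<Rightarrow> 'n cfun \<Rightarrow> 'n cfun" where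
  "mi_mult \<alpha> \<phi> = (\<lambda>x. complex_of_real (\<Prod>j\<in>UNIV. (x $ j) ^ \<alpha> j) * \<phi> x)"

definition L1m :: "nat \<Rightarrow> ('n::finite) cfun set" where
  "L1m m = {\<phi> \<in> Lp 1. \<forall>\<alpha>. mi_order \<alpha> \<le> m \<longrightarrow> mi_mult \<alpha> \<phi> \<in> Lp 1}"

definition L1m_norm :: "nat \<Rightarrow> ('n::finite) cfun \<Rightarrow> ennreal" where
  "L1m_norm m \<phi> = (\<Sum>\<alpha> | mi_order \<alpha> \<le> m. Lp_norm 1 (mi_mult \<alpha> \<phi>))"

lemma finite_mi_order_le: "finite {\<alpha> :: 'n::finite \<Rightarrow> nat. mi_order \<alpha> \<le> m}"
proof (rule finite_subset)
  show "{\<alpha> :: 'n \<Rightarrow> nat. mi_order \<alpha> \<le> m} \<subseteq> PiE UNIV (\<lambda>_. {..m})"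
  proof (intro subsetI, unfold PiE_UNIV_domain, intro Pi_I)
    fix \<alpha> :: "'n \<Rightarrow> nat" and j :: 'n
    assume "\<alpha> \<in> {\<alpha>. mi_order \<alpha> \<le> m}"
    moreover have "\<alpha> j \<le> (\<Sum>i\<in>UNIV. \<alpha> i)"
      by (rule member_le_sum) auto
    ultimately show "\<alpha> j \<in> {..m}"
      by (simp add: mi_order_def)
  qed
  show "finite (PiE (UNIV :: 'n set) (\<lambda>_. {..m}))"
    by (intro finite_PiE) auto
qed

lemma Lp_1_iff_integrable: "\<phi> \<in> Lp 1 \<longleftrightarrow> integrable lborel \<phi>"
  by (simp add: Lp_def Lp_norm_def Let_def integrable_iff_bounded less_top)


text \<open>
  \<^term>\<open>cont_into S E N\<close> is \<open>C(S; E)\<close>. For a continuous curve, membership in \<open>L\<^sup>\<infinity>(S; E)\<close> only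
  requires that the norm along the curve be essentially bounded, its measurability being automatic.
\<close>

definition cont_into ::
    "real set \<Rightarrow> ('n::finite) cfun set \<Rightarrow> ('n cfun \<Rightarrow> ennreal) \<Rightarrow> (real \<Rightarrow> 'n cfun) set" where
  "cont_into S E N =
     {u. (\<forall>t\<in>S. u t \<in> E) \<and>
         (\<forall>t\<in>S. ((\<lambda>s. N (\<lambda>x. u s x - u t x)) \<longlongrightarrow> 0) (at t within S))}"

definition bdd_cont_into ::
    "real set \<Rightarrow> ('n::finite) cfun set \<Rightarrow> ('n cfun \<Rightarrow> ennreal) \<Rightarrow> (real \<Rightarrow> 'n cfun) set" where
  "bdd_cont_into S E N =
     {u \<in> cont_into S E N. esssup (restrict_space lborel S) (\<lambda>t. N (u t)) < \<infinity>}"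

definition solution_space :: "(real \<Rightarrow> ('n::finite) cfun) set" where
  "solution_space =
     bdd_cont_into {0..} (Lp 1) (Lp_norm 1) \<inter> bdd_cont_into {0<..} (Lp \<infinity>) (Lp_norm \<infinity>)"


text \<open>
  \<^term>\<open>has_bochner_integral_in E N M g v\<close>: \<^term>\<open>v\<close> is the Bochner integral over \<^term>\<open>M\<close> of the
  \<^term>\<open>E\<close>-valued function \<^term>\<open>g\<close> with respect to the norm \<^term>\<open>N\<close>. This follows the library's
  \<^const>\<open>has_bochner_integral\<close>, which is not applicable because function spaces modulo null sets are
  not types of class \<^class>\<open>real_normed_vector\<close>. Strong measurability of \<^term>\<open>g\<close> is a
  consequence of the approximation by simple functions in the mean.
\<close>

definition simple_integrable_into ::
    "('n::finite) cfun set \<Rightarrow> 'a measure \<Rightarrow> ('a \<Rightarrow> 'n cfun) \<Rightarrow> bool" where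
  "simple_integrable_into E M h \<longleftrightarrow>
     simple_function M h \<and> (\<forall>s\<in>space M. h s \<in> E) \<and>
     emeasure M {s \<in> space M. h s \<noteq> (\<lambda>x. 0)} \<noteq> \<infinity>"

definition simple_integral_into ::
    "'a measure \<Rightarrow> ('a \<Rightarrow> ('n::finite) cfun) \<Rightarrow> 'n cfun" where
  "simple_integral_into M h =
     (\<lambda>x. \<Sum>\<phi>\<in>h ` space M. measure M {s \<in> space M. h s = \<phi>} *\<^sub>R \<phi> x)"

definition has_bochner_integral_in ::
    "('n::finite) cfun set \<Rightarrow> ('n cfun \<Rightarrow> ennreal) \<Rightarrow> 'a measure \<Rightarrow> ('a \<Rightarrow> 'n cfun) \<Rightarrow> 'n cfun \<Rightarrow> bool"
  where
  "has_bochner_integral_in E N M g v \<longleftrightarrow>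
     v \<in> E \<and> (AE s in M. g s \<in> E) \<and>
     (\<exists>h :: nat \<Rightarrow> 'a \<Rightarrow> 'n cfun.
        (\<forall>i. simple_integrable_into E M (h i)) \<and>
        (\<forall>i. (\<lambda>s. N (\<lambda>x. g s x - h i s x)) \<in> borel_measurable M) \<and>
        (\<lambda>i. \<integral>\<^sup>+s. N (\<lambda>x. g s x - h i s x) \<partial>M) \<longlonglongrightarrow> 0 \<and>
        (\<lambda>i. N (\<lambda>x. simple_integral_into M (h i) x - v x)) \<longlonglongrightarrow> 0)"


text \<open>The complex \<^const>\<open>powr\<close> is the principal branch of the power.\<close>

definition heat_kernel :: "complex \<Rightarrow> real \<Rightarrow> ('n::finite) cfun" where
  "heat_kernel \<nu> t x =
     (complex_of_real (4 * pi * t) * \<nu>) powr (- (of_nat CARD('n) / 2)) *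
     exp (- complex_of_real ((norm x)\<^sup>2) / (complex_of_real (4 * t) * \<nu>))"

definition heat_semigroup :: "complex \<Rightarrow> real \<Rightarrow> ('n::finite) cfun \<Rightarrow> 'n cfun" where
  "heat_semigroup \<nu> t \<phi> =
     (if t = 0 then \<phi> else (\<lambda>x. \<integral>y. heat_kernel \<nu> t (x - y) * \<phi> y \<partial>lborel))"

text \<open>
  The identity \<open>u(t) = e\<^bsup>t\<nu>\<Delta>\<^esup> u\<^sub>0 + \<integral>\<^sub>0\<^sup>t e\<^bsup>(t-s)\<nu>\<Delta>\<^esup> f(u(s)) ds\<close> is stated by saying that
  \<open>u(t) - e\<^bsup>t\<nu>\<Delta>\<^esup> u\<^sub>0\<close> is the Bochner integral in \<open>L\<^sup>1 \<inter> L\<^sup>\<infinity>\<close>.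
\<close>

definition global_mild_solution ::
    "complex \<Rightarrow> (complex \<Rightarrow> complex) \<Rightarrow> ('n::finite) cfun \<Rightarrow> (real \<Rightarrow> 'n cfun) \<Rightarrow> bool" where
  "global_mild_solution \<nu> f u\<^sub>0 u \<longleftrightarrow>
     u \<in> solution_space \<and>
     (\<forall>t>0. has_bochner_integral_in (Lp 1 \<inter> Lp \<infinity>) L1_Linf_norm (restrict_space lborel {0<..<t})
        (\<lambda>s. heat_semigroup \<nu> (t - s) (\<lambda>x. f (u s x)))
        (\<lambda>x. u t x - heat_semigroup \<nu> t u\<^sub>0 x))"

end

theory Submission
  imports Defs "HOL-Probability.Distributions"
begin

text \<open>
  The uniform bound on \<open>t\<^bsup>n/2\<^esup> \<parallel>u(t)\<parallel>\<^sub>\<infinity>\<close> gives \<open>\<bar>f(u(s))\<bar> \<le> a(s) \<bar>u(s)\<bar>\<close> with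
  \<open>a(s) = A (1 + s)\<^bsup>-n(p-1)/2\<^esup>\<close>, and \<open>a\<close> is integrable on \<open>(0, \<infinity>)\<close> because \<open>p > 1 + 2/n\<close>. If
  a bounded weight \<open>w\<close> satisfies \<open>\<integral> w(x) \<bar>G(x - y)\<bar> dx \<le> C w(y) + \<beta>(y)\<close> for all heat kernels \<open>G\<close> up
  to time \<open>T\<close>, then Duhamel's formula and Gronwall's inequality bound \<open>\<parallel>w u(t)\<parallel>\<^sub>1\<close> on \<open>[0, T]\<close> by
  the weighted norms of \<open>u\<^sub>0\<close> and the supremum of \<open>\<parallel>\<beta> u(t)\<parallel>\<^sub>1\<close>, independently of \<open>sup w\<close>. The weights
  \<open>min(\<bar>x\<bar>, L)\<^sup>m\<close> yield the moment bound as \<open>L \<rightarrow> \<infinity>\<close>; the weights \<open>min((\<bar>x\<bar> - R)\<^sup>+, L)\<^sup>m\<close>, for which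
  \<open>\<beta> = O(1/R)\<close>, show that the tails of \<open>\<bar>x\<bar>\<^sup>m u(t)\<close> are small uniformly on \<open>[0, T]\<close>, which upgrades
  continuity in \<open>L\<^sup>1\<close> to continuity in \<open>L\<^sup>1\<^sub>m\<close>.
\<close>

section \<open>Weighted L1 norms and their compatibility with Bochner integrals\<close>

definition weighted_norm :: "(real ^ 'n \<Rightarrow> real) \<Rightarrow> ('n::finite) cfun \<Rightarrow> ennreal" where
  "weighted_norm w \<phi> = (\<integral>\<^sup>+x. ennreal (w x * norm (\<phi> x)) \<partial>lborel)"

lemma Lp_norm_1: "Lp_norm 1 \<phi> = (\<integral>\<^sup>+x. ennreal (norm (\<phi> x)) \<partial>lborel)"
  by (simp add: Lp_norm_def Let_def top.not_eq_extremum)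

lemma Lp_norm_1_eq_weighted_norm: "Lp_norm 1 \<phi> = weighted_norm (\<lambda>x. 1) \<phi>"
  by (simp add: Lp_norm_1 weighted_norm_def)

lemma weighted_norm_triangle:
  assumes "w \<in> borel_measurable borel" "\<And>x. 0 \<le> w x"
    and "\<phi> \<in> borel_measurable borel" "\<psi> \<in> borel_measurable borel"
    and "\<And>x. norm (\<zeta> x) \<le> norm (\<phi> x) + norm (\<psi> x)"
  shows "weighted_norm w \<zeta> \<le> weighted_norm w \<phi> + weighted_norm w \<psi>"
proof -
  have "weighted_norm w \<zeta> \<le> (\<integral>\<^sup>+x. ennreal (w x * norm (\<phi> x)) + ennreal (w x * norm (\<psi> x)) \<partial>lborel)"
    unfolding weighted_norm_def
  proof (rule nn_integral_mono)
    fix x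
    have "w x * norm (\<zeta> x) \<le> w x * norm (\<phi> x) + w x * norm (\<psi> x)"
      using mult_left_mono[OF assms(5)[of x] assms(2)[of x]] by (simp add: algebra_simps)
    then show "ennreal (w x * norm (\<zeta> x)) \<le> ennreal (w x * norm (\<phi> x)) + ennreal (w x * norm (\<psi> x))"
      using assms(2)[of x] by (simp flip: ennreal_plus)
  qed
  also have "\<dots> = weighted_norm w \<phi> + weighted_norm w \<psi>"
    unfolding weighted_norm_def using assms by (intro nn_integral_add) auto
  finally show ?thesis .
qed

lemma weighted_norm_le_Lp_norm_1:
  assumes "\<And>x. 0 \<le> w x" "\<And>x. w x \<le> L" "\<phi> \<in> borel_measurable borel"
  shows "weighted_norm w \<phi> \<le> ennreal L * Lp_norm 1 \<phi>"
proof -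
  have L: "0 \<le> L" using assms(1,2) order_trans by blast
  have "weighted_norm w \<phi> \<le> (\<integral>\<^sup>+x. ennreal L * ennreal (norm (\<phi> x)) \<partial>lborel)"
    unfolding weighted_norm_def using assms L
    by (intro nn_integral_mono) (auto simp flip: ennreal_mult intro!: ennreal_leI mult_right_mono)
  also have "\<dots> = ennreal L * Lp_norm 1 \<phi>"
    unfolding Lp_norm_1 using assms by (intro nn_integral_cmult) auto
  finally show ?thesis .
qed

text \<open>Minkowski's inequality for finitely many values: the triangle inequality acts pointwise
  in x, and the sum over values is regrouped as an integral over s. Finiteness of \<open>M\<close>
  lets the real-valued \<open>measure\<close> be replaced by \<open>emeasure\<close>.\<close>

lemma weighted_norm_simple_integral_le:
  assumes M: "finite_measure M"
    and h: "simple_integrable_into E M h" and E: "E \<subseteq> borel_measurable borel"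
    and w: "w \<in> borel_measurable borel" "\<And>x. 0 \<le> w x"
  shows "weighted_norm w (simple_integral_into M h) \<le> (\<integral>\<^sup>+s. weighted_norm w (h s) \<partial>M)"
proof -
  interpret finite_measure M by fact
  define I where "I = h ` space M"
  define A where "A \<phi> = {s \<in> space M. h s = \<phi>}" for \<phi>
  have sf: "simple_function M h" and hE: "\<And>s. s \<in> space M \<Longrightarrow> h s \<in> E"
    using h by (auto simp: simple_integrable_into_def)
  have fin: "finite I" using sf by (simp add: I_def simple_function_def)
  have A: "A \<phi> \<in> sets M" for \<phi>
    using simple_functionD(2)[OF sf, of "{\<phi>}"] by (simp add: A_def vimage_def Int_def conj_commute)
  have mI: "\<phi> \<in> borel_measurable borel" if "\<phi> \<in> I" for \<phi>
    using that hE E by (auto simp: I_def)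
  have "weighted_norm w (simple_integral_into M h)
      \<le> (\<integral>\<^sup>+x. (\<Sum>\<phi>\<in>I. emeasure M (A \<phi>) * ennreal (w x * norm (\<phi> x))) \<partial>lborel)"
    unfolding weighted_norm_def
  proof (rule nn_integral_mono)
    fix x
    have "w x * norm (simple_integral_into M h x) \<le> w x * (\<Sum>\<phi>\<in>I. measure M (A \<phi>) * norm (\<phi> x))"
      unfolding simple_integral_into_def I_def[symmetric] A_def[symmetric]
      by (intro mult_left_mono w order_trans[OF norm_sum] sum_mono) auto
    also have "\<dots> = (\<Sum>\<phi>\<in>I. measure M (A \<phi>) * (w x * norm (\<phi> x)))"
      by (simp add: sum_distrib_left mult_ac)
    finally show "ennreal (w x * norm (simple_integral_into M h x))
        \<le> (\<Sum>\<phi>\<in>I. emeasure M (A \<phi>) * ennreal (w x * norm (\<phi> x)))"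
      using w(2)[of x] by (simp add: emeasure_eq_measure ennreal_leI sum_ennreal flip: ennreal_mult')
  qed
  also have "\<dots> = (\<Sum>\<phi>\<in>I. emeasure M (A \<phi>) * weighted_norm w \<phi>)"
    unfolding weighted_norm_def using mI w
    by (subst nn_integral_sum) (auto intro!: sum.cong nn_integral_cmult)
  also have "\<dots> = (\<Sum>\<phi>\<in>I. \<integral>\<^sup>+s. weighted_norm w \<phi> * indicator (A \<phi>) s \<partial>M)"
    using A by (simp add: nn_integral_cmult_indicator mult.commute)
  also have "\<dots> = (\<integral>\<^sup>+s. (\<Sum>\<phi>\<in>I. weighted_norm w \<phi> * indicator (A \<phi>) s) \<partial>M)"
    using A by (subst nn_integral_sum) auto
  also have "\<dots> = (\<integral>\<^sup>+s. weighted_norm w (h s) \<partial>M)"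
  proof (rule nn_integral_cong)
    fix s assume s: "s \<in> space M"
    have "(\<Sum>\<phi>\<in>I. weighted_norm w \<phi> * indicator (A \<phi>) s) = (\<Sum>\<phi>\<in>I. if \<phi> = h s then weighted_norm w (h s) else 0)"
      using s by (intro sum.cong) (auto simp: A_def)
    also have "\<dots> = weighted_norm w (h s)" using fin s by (subst sum.delta) (auto simp: I_def)
    finally show "(\<Sum>\<phi>\<in>I. weighted_norm w \<phi> * indicator (A \<phi>) s) = weighted_norm w (h s)" .
  qed
  finally show ?thesis .
qed

text \<open>Minkowski's inequality passes to the Bochner integral because a weight bounded by
  \<open>L\<close> makes the weighted norm at most \<open>L\<close> times
  \<open>L1_Linf_norm\<close>. The errors of the simple approximations carry the factor
  \<open>L\<close> but vanish in the limit, so \<open>L\<close> is absent from the conclusion. The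
  majorant \<open>b\<close> is integrated in place of the weighted norm of \<open>g s\<close>, whose
  measurability in s is thus never in question.\<close>

lemma weighted_norm_bochner_le:
  assumes M: "finite_measure M"
    and int: "has_bochner_integral_in (Lp 1 \<inter> Lp \<infinity>) L1_Linf_norm M g v"
    and w: "w \<in> borel_measurable borel" "\<And>x. 0 \<le> w x" "\<And>x. w x \<le> L"
    and b: "b \<in> borel_measurable M" "AE s in M. weighted_norm w (g s) \<le> b s"
  shows "weighted_norm w v \<le> (\<integral>\<^sup>+s. b s \<partial>M)"
proof -
  obtain h where h: "\<And>i. simple_integrable_into (Lp 1 \<inter> Lp \<infinity>) M (h i)"
    and hm: "\<And>i. (\<lambda>s. L1_Linf_norm (\<lambda>x. g s x - h i s x)) \<in> borel_measurable M"
    and h1: "(\<lambda>i. \<integral>\<^sup>+s. L1_Linf_norm (\<lambda>x. g s x - h i s x) \<partial>M) \<longlonglongrightarrow> 0"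
    and h2: "(\<lambda>i. L1_Linf_norm (\<lambda>x. simple_integral_into M (h i) x - v x)) \<longlonglongrightarrow> 0"
    using int by (auto simp: has_bochner_integral_in_def)
  have v: "v \<in> borel_measurable borel" and gE: "AE s in M. g s \<in> borel_measurable borel"
    using int by (auto simp: has_bochner_integral_in_def Lp_def)
  have hE: "h i s \<in> borel_measurable borel" if "s \<in> space M" for i s
    using h[of i] that by (auto simp: simple_integrable_into_def Lp_def)
  have iE: "simple_integral_into M (h i) \<in> borel_measurable borel" for i
    unfolding simple_integral_into_def using hE by (intro borel_measurable_sum) auto
  have sub: "Lp 1 \<inter> Lp \<infinity> \<subseteq> (borel_measurable borel :: ('n::finite) cfun set)"
    by (auto simp: Lp_def)
  have wL: "weighted_norm w \<phi> \<le> ennreal L * L1_Linf_norm \<phi>" if "\<phi> \<in> borel_measurable borel" for \<phi>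
    using weighted_norm_le_Lp_norm_1[OF w(2,3) that]
    by (rule order_trans) (auto simp: L1_Linf_norm_def intro!: mult_left_mono)
  define e where "e i = ennreal L * L1_Linf_norm (\<lambda>x. simple_integral_into M (h i) x - v x) +
     ((\<integral>\<^sup>+s. b s \<partial>M) + ennreal L * (\<integral>\<^sup>+s. L1_Linf_norm (\<lambda>x. g s x - h i s x) \<partial>M))" for i
  have "e \<longlonglongrightarrow> ennreal L * 0 + ((\<integral>\<^sup>+s. b s \<partial>M) + ennreal L * 0)"
    unfolding e_def by (intro tendsto_intros ennreal_tendsto_cmult h1 h2) auto
  moreover have "weighted_norm w v \<le> e i" for i
  proof -
    have "weighted_norm w v \<le> weighted_norm w (\<lambda>x. simple_integral_into M (h i) x - v x)
        + weighted_norm w (simple_integral_into M (h i))"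
    proof (rule weighted_norm_triangle[OF w(1,2)])
      show "norm (v x) \<le> norm (simple_integral_into M (h i) x - v x) + norm (simple_integral_into M (h i) x)" for x
        using norm_triangle_sub[of "v x" "simple_integral_into M (h i) x"]
        by (simp add: norm_minus_commute add.commute)
    qed (use v iE in auto)
    also have "\<dots> \<le> ennreal L * L1_Linf_norm (\<lambda>x. simple_integral_into M (h i) x - v x)
        + (\<integral>\<^sup>+s. weighted_norm w (h i s) \<partial>M)"
      using v iE by (intro add_mono wL weighted_norm_simple_integral_le[OF M h sub w(1,2)]) auto
    also have "(\<integral>\<^sup>+s. weighted_norm w (h i s) \<partial>M)
       \<le> (\<integral>\<^sup>+s. b s + ennreal L * L1_Linf_norm (\<lambda>x. g s x - h i s x) \<partial>M)"
    proof (rule nn_integral_mono_AE)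
      show "AE s in M. weighted_norm w (h i s) \<le> b s + ennreal L * L1_Linf_norm (\<lambda>x. g s x - h i s x)"
        using b(2) gE AE_space
      proof eventually_elim
        case (elim s)
        have "weighted_norm w (h i s) \<le> weighted_norm w (g s) + weighted_norm w (\<lambda>x. g s x - h i s x)"
        proof (rule weighted_norm_triangle[OF w(1,2)])
          show "norm (h i s x) \<le> norm (g s x) + norm (g s x - h i s x)" for x
            using norm_triangle_sub[of "h i s x" "g s x"] by (simp add: norm_minus_commute)
        qed (use elim hE[of s i] in auto)
        also have "\<dots> \<le> b s + ennreal L * L1_Linf_norm (\<lambda>x. g s x - h i s x)"
          using elim hE[of s i] by (intro add_mono wL) auto
        finally show ?case .
      qed
    qed
    also have "\<dots> = (\<integral>\<^sup>+s. b s \<partial>M) + ennreal L * (\<integral>\<^sup>+s. L1_Linf_norm (\<lambda>x. g s x - h i s x) \<partial>M)"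
      using b hm[of i] by (simp add: nn_integral_add nn_integral_cmult)
    finally show ?thesis unfolding e_def by (simp add: add_left_mono)
  qed
  ultimately show ?thesis by (intro LIMSEQ_le_const[of e]) (auto intro!: exI)
qed

section \<open>Gaussian bounds and moments of the complex heat kernel\<close>

lemma norm_heat_kernel:
  fixes x :: "real ^ 'n::finite"
  assumes "0 < Re \<nu>" "0 < t"
  shows "norm (heat_kernel \<nu> t x) = (4 * pi * t * norm \<nu>) powr (- (real CARD('n) / 2)) *
     exp (- (Re \<nu> / (4 * (norm \<nu>)\<^sup>2) / t * (norm x)\<^sup>2))"
proof -
  have "Re (- complex_of_real ((norm x)\<^sup>2) / (complex_of_real (4 * t) * \<nu>)) = - (norm x)\<^sup>2 / (4 * t) * Re (1 / \<nu>)"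
  proof -
    have "- complex_of_real ((norm x)\<^sup>2) / (complex_of_real (4 * t) * \<nu>)
        = complex_of_real (- (norm x)\<^sup>2 / (4 * t)) * (1 / \<nu>)"
      by simp
    then show ?thesis
      by (simp only: times_complex.sel Re_complex_of_real Im_complex_of_real)
  qed
  \<comment> \<open>This is positive since Re \<nu> > 0, so the modulus of the kernel is a genuine
    Gaussian even when \<nu> is not real.\<close>
  also have "Re (1 / \<nu>) = Re \<nu> / (norm \<nu>)\<^sup>2"
    by (simp add: Re_divide cmod_power2)
  finally have 1: "norm (exp (- complex_of_real ((norm x)\<^sup>2) / (complex_of_real (4 * t) * \<nu>))) = exp (- (Re \<nu> / (4 * (norm \<nu>)\<^sup>2) / t * (norm x)\<^sup>2))"
    by (simp add: norm_exp_eq_Re field_simps)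
  \<comment> \<open>For a real exponent the modulus of the principal power depends only on the
    modulus of the base, so the argument of \<nu> drops out.\<close>
  have R: "(- (of_nat CARD('n) / 2) :: complex) \<in> \<real>" by auto
  have 2: "norm ((complex_of_real (4 * pi * t) * \<nu>) powr (- (of_nat CARD('n) / 2))) = (4 * pi * t * norm \<nu>) powr (- (real CARD('n) / 2))"
    using assms by (subst norm_powr_real_powr'[OF R]) (auto simp: norm_mult)
  show ?thesis unfolding heat_kernel_def norm_mult 1 2 ..
qed

lemma heat_kernel_measurable [measurable]: "heat_kernel \<nu> t \<in> borel_measurable borel"
  unfolding heat_kernel_def by measurable

text \<open>The Gaussian factors over the coordinates, and each factor is a multiple of a centred
  normal density whose variance is fixed by \<open>2 * \<sigma>\<^sup>2 = 1 / c\<close>.\<close>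

lemma nn_integral_gaussian:
  assumes c: "0 < c"
  shows "(\<integral>\<^sup>+x. ennreal (exp (- (c * (norm (x :: real ^ 'n::finite))\<^sup>2))) \<partial>lborel) = ennreal ((pi / c) powr (real CARD('n) / 2))"
proof -
  define \<sigma> where "\<sigma> = 1 / sqrt (2 * c)"
  have \<sigma>: "0 < \<sigma>" "2 * \<sigma>\<^sup>2 = 1 / c" using c by (auto simp: \<sigma>_def power_divide)
  have *: "ennreal (exp (- (c * x\<^sup>2))) = ennreal (sqrt (pi / c)) * ennreal (normal_density 0 \<sigma> x)" for x
  proof -
    have "2 * pi * \<sigma>\<^sup>2 = pi * (2 * \<sigma>\<^sup>2)" by simp
    then have 1: "2 * pi * \<sigma>\<^sup>2 = pi / c" using \<sigma>(2) by simp
    have 2: "x\<^sup>2 / (2 * \<sigma>\<^sup>2) = c * x\<^sup>2" unfolding \<sigma>(2) by simp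
    show ?thesis unfolding normal_density_def using 1 2 c by (simp flip: ennreal_mult)
  qed
  have one: "(\<integral>\<^sup>+x. ennreal (exp (- (c * x\<^sup>2))) \<partial>lborel) = ennreal (sqrt (pi / c))"
    unfolding * using \<sigma> c
    by (simp add: nn_integral_cmult nn_integral_eq_integral integrable_normal_density)
  have "(\<integral>\<^sup>+x. ennreal (exp (- (c * (norm (x :: real ^ 'n))\<^sup>2))) \<partial>lborel)
      = (\<integral>\<^sup>+x. (\<Prod>b\<in>Basis. ennreal (exp (- (c * ((x :: real ^ 'n) \<bullet> b)\<^sup>2)))) \<partial>lborel)"
  proof (rule nn_integral_cong)
    fix x :: "real ^ 'n"
    have "(norm x)\<^sup>2 = (\<Sum>b\<in>Basis. (x \<bullet> b)\<^sup>2)"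
      unfolding power2_norm_eq_inner by (subst euclidean_inner) (simp add: power2_eq_square)
    then show "ennreal (exp (- (c * (norm x)\<^sup>2))) = (\<Prod>b\<in>Basis. ennreal (exp (- (c * (x \<bullet> b)\<^sup>2))))"
      by (simp add: prod_ennreal exp_sum sum_distrib_left flip: sum_negf)
  qed
  also have "\<dots> = (\<Prod>b\<in>(Basis :: (real ^ 'n) set). \<integral>\<^sup>+x. ennreal (exp (- (c * x\<^sup>2))) \<partial>lborel)"
    by (rule nn_integral_lborel_prod) auto
  also have "\<dots> = ennreal ((sqrt (pi / c)) ^ CARD('n))"
    unfolding one using c by (simp add: ennreal_power)
  also have "(sqrt (pi / c)) ^ CARD('n) = (pi / c) powr (real CARD('n) / 2)"
    using c by (simp add: powr_half_sqrt[symmetric] powr_powr flip: powr_realpow)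
  finally show ?thesis .
qed

text \<open>Half of the Gaussian absorbs the power: \<open>z ^ k / fact k\<close> is one term of the
  series of \<open>exp z\<close>, and z \<le> 1/2 + z^2/2.\<close>

lemma power_mult_exp_neg_square_le:
  fixes z :: real
  assumes "0 \<le> z"
  shows "z ^ k * exp (- z\<^sup>2) \<le> fact k * exp (1/2) * exp (- z\<^sup>2 / 2)"
proof -
  have "z ^ k / fact k \<le> exp z"
    using sum_le_suminf[OF summable_exp_generic, of "{k}" z] assms
    by (simp add: exp_def divide_inverse mult.commute)
  then have "z ^ k \<le> fact k * exp z" by (simp add: field_simps)
  also have "\<dots> \<le> fact k * exp (1/2 + z\<^sup>2/2)"
    using zero_le_power2[of "z - 1"] by (simp add: power2_eq_square algebra_simps)
  finally have "z ^ k * exp (- z\<^sup>2) \<le> fact k * exp (1/2 + z\<^sup>2/2) * exp (- z\<^sup>2)"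
    by (intro mult_right_mono) auto
  also have "\<dots> = fact k * exp (1/2) * exp (- z\<^sup>2 / 2)"
    by (simp add: mult.assoc flip: exp_add)
  finally show ?thesis .
qed

text \<open>Parabolic scaling: in the variable \<open>y = sqrt (\<kappa> / \<tau>) * norm z\<close>
  the power \<open>y ^ k\<close> is absorbed by half of the Gaussian. The integral of the remaining
  half is proportional to \<tau>^(n/2), which cancels the prefactor \<tau>^(-n/2) of the kernel, so
  only the factor \<open>sqrt \<tau> ^ k\<close> from the change of variable depends on
  \<tau>.\<close>

lemma heat_kernel_moment:
  assumes \<nu>: "0 < Re \<nu>"
  shows "\<exists>c\<ge>0. \<forall>\<tau>>0. (\<integral>\<^sup>+z. ennreal (norm z ^ k * norm (heat_kernel \<nu> \<tau> (z :: real ^ 'n::finite))) \<partial>lborel)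
    \<le> ennreal (c * sqrt \<tau> ^ k)"
proof (intro exI conjI allI impI)
  define \<kappa> where "\<kappa> = Re \<nu> / (4 * (norm \<nu>)\<^sup>2)"
  have \<nu>0: "0 < norm \<nu>" using \<nu> by auto
  have \<kappa>: "0 < \<kappa>" using \<nu> \<nu>0 by (simp add: \<kappa>_def)
  define d where "d = fact k * exp (1/2 :: real)"
  define q where "q = real CARD('n) / 2"
  define c where "c = sqrt (1 / \<kappa>) ^ k * d * (1 / (2 * \<kappa> * norm \<nu>)) powr q"
  show "0 \<le> c" using \<kappa> by (auto simp: c_def d_def)
  fix \<tau> :: real assume \<tau>: "0 < \<tau>"
  define b where "b = (4 * pi * \<tau> * norm \<nu>) powr (- q) * (sqrt (\<tau> / \<kappa>) ^ k * d)"
  have b: "0 \<le> b" using \<kappa> \<tau> by (auto simp: b_def d_def)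
  have pt: "norm z ^ k * norm (heat_kernel \<nu> \<tau> z) \<le> b * exp (- (\<kappa> / (2 * \<tau>) * (norm z)\<^sup>2))" for z :: "real ^ 'n"
  proof -
    define y where "y = sqrt (\<kappa> / \<tau>) * norm z"
    have y: "0 \<le> y" "y\<^sup>2 = \<kappa> / \<tau> * (norm z)\<^sup>2" "norm z = sqrt (\<tau> / \<kappa>) * y"
      using \<kappa> \<tau> by (simp_all add: y_def power_mult_distrib real_sqrt_divide power_divide)
    have "norm z ^ k * norm (heat_kernel \<nu> \<tau> z) = (4 * pi * \<tau> * norm \<nu>) powr (- q) * sqrt (\<tau> / \<kappa>) ^ k * (y ^ k * exp (- y\<^sup>2))"
      unfolding norm_heat_kernel[OF \<nu> \<tau>] \<kappa>_def[symmetric] q_def[symmetric] y(2)[symmetric]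
      by (subst y(3)) (simp add: power_mult_distrib)
    also have "\<dots> \<le> (4 * pi * \<tau> * norm \<nu>) powr (- q) * sqrt (\<tau> / \<kappa>) ^ k * (d * exp (- y\<^sup>2 / 2))"
      unfolding d_def using \<kappa> \<tau> by (intro mult_left_mono power_mult_exp_neg_square_le y) auto
    also have "\<dots> = b * exp (- (\<kappa> / (2 * \<tau>) * (norm z)\<^sup>2))"
      unfolding b_def y(2) by simp
    finally show ?thesis .
  qed
  have "(\<integral>\<^sup>+z. ennreal (norm z ^ k * norm (heat_kernel \<nu> \<tau> (z :: real ^ 'n))) \<partial>lborel)
     \<le> (\<integral>\<^sup>+z. ennreal b * ennreal (exp (- (\<kappa> / (2 * \<tau>) * (norm (z :: real ^ 'n))\<^sup>2))) \<partial>lborel)"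
    using pt b by (intro nn_integral_mono) (simp add: ennreal_leI flip: ennreal_mult)
  also have "\<dots> = ennreal (b * (pi / (\<kappa> / (2 * \<tau>))) powr q)"
    using \<kappa> \<tau> b nn_integral_gaussian[of "\<kappa> / (2 * \<tau>)", where 'n = 'n]
    by (subst nn_integral_cmult) (auto simp: ennreal_mult q_def)
  also have "b * (pi / (\<kappa> / (2 * \<tau>))) powr q = c * sqrt \<tau> ^ k"
  proof -
    have "(4 * pi * \<tau> * norm \<nu>) powr (- q) * (pi / (\<kappa> / (2 * \<tau>))) powr q
        = ((pi / (\<kappa> / (2 * \<tau>))) / (4 * pi * \<tau> * norm \<nu>)) powr q"
      using \<kappa> \<tau> \<nu>0 by (subst powr_divide) (auto simp: powr_minus_divide)
    also have "(pi / (\<kappa> / (2 * \<tau>))) / (4 * pi * \<tau> * norm \<nu>) = 1 / (2 * \<kappa> * norm \<nu>)"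
      using \<kappa> \<tau> \<nu>0 by (simp add: field_simps)
    finally have 1: "(4 * pi * \<tau> * norm \<nu>) powr (- q) * (pi / (\<kappa> / (2 * \<tau>))) powr q = (1 / (2 * \<kappa> * norm \<nu>)) powr q" .
    have "b * (pi / (\<kappa> / (2 * \<tau>))) powr q
        = ((4 * pi * \<tau> * norm \<nu>) powr (- q) * (pi / (\<kappa> / (2 * \<tau>))) powr q) * (sqrt (\<tau> / \<kappa>) ^ k * d)"
      by (simp add: b_def mult_ac)
    also have "\<dots> = c * sqrt \<tau> ^ k"
      unfolding 1 c_def by (simp add: real_sqrt_divide power_divide)
    finally show ?thesis .
  qed
  finally show "(\<integral>\<^sup>+z. ennreal (norm z ^ k * norm (heat_kernel \<nu> \<tau> (z :: real ^ 'n))) \<partial>lborel)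
    \<le> ennreal (c * sqrt \<tau> ^ k)" .
qed

text \<open>Tonelli's theorem moves the weight onto the kernel, which leaves the weighted mass of a
  single kernel centred at \<open>y\<close> to be estimated.\<close>

lemma weighted_norm_heat_semigroup_le:
  fixes \<phi> :: "real ^ 'n::finite \<Rightarrow> complex"
  assumes t: "0 < t" and \<phi> [measurable]: "\<phi> \<in> borel_measurable borel"
    and w [measurable]: "w \<in> borel_measurable borel" and w0: "\<And>x. 0 \<le> w x"
  shows "weighted_norm w (heat_semigroup \<nu> t \<phi>)
    \<le> (\<integral>\<^sup>+y. (\<integral>\<^sup>+x. ennreal (w x * norm (heat_kernel \<nu> t (x - y))) \<partial>lborel) * ennreal (norm (\<phi> y)) \<partial>lborel)"
proof -
  define F where "F x y = ennreal (w x * norm (heat_kernel \<nu> t (x - y))) * ennreal (norm (\<phi> y))" for x y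
  have F [measurable]: "(\<lambda>(x, y). F x y) \<in> borel_measurable (lborel \<Otimes>\<^sub>M lborel)"
    unfolding F_def by measurable
  have "weighted_norm w (heat_semigroup \<nu> t \<phi>) \<le> (\<integral>\<^sup>+x. (\<integral>\<^sup>+y. F x y \<partial>lborel) \<partial>lborel)"
    unfolding weighted_norm_def
  proof (rule nn_integral_mono)
    fix x
    \<comment> \<open>The convolution integral may fail to converge at \<open>x\<close>; it then has
      the default value 0 and the bound is trivial.\<close>
    have "ennreal (norm (heat_semigroup \<nu> t \<phi> x)) \<le> (\<integral>\<^sup>+y. ennreal (norm (heat_kernel \<nu> t (x - y) * \<phi> y)) \<partial>lborel)"
      using t integral_norm_bound_ennreal[of lborel "\<lambda>y. heat_kernel \<nu> t (x - y) * \<phi> y"]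
      by (cases "integrable lborel (\<lambda>y. heat_kernel \<nu> t (x - y) * \<phi> y)")
        (auto simp: heat_semigroup_def not_integrable_integral_eq)
    then have "ennreal (w x) * ennreal (norm (heat_semigroup \<nu> t \<phi> x))
       \<le> ennreal (w x) * (\<integral>\<^sup>+y. ennreal (norm (heat_kernel \<nu> t (x - y) * \<phi> y)) \<partial>lborel)"
      by (rule mult_left_mono) simp
    also have "\<dots> = (\<integral>\<^sup>+y. F x y \<partial>lborel)"
      using w0[of x] by (subst nn_integral_cmult[symmetric])
        (auto simp: F_def norm_mult ennreal_mult mult_ac intro!: nn_integral_cong)
    finally show "ennreal (w x * norm (heat_semigroup \<nu> t \<phi> x)) \<le> (\<integral>\<^sup>+y. F x y \<partial>lborel)"
      using w0[of x] by (simp add: ennreal_mult)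
  qed
  also have "\<dots> = (\<integral>\<^sup>+y. (\<integral>\<^sup>+x. F x y \<partial>lborel) \<partial>lborel)"
    by (rule lborel_pair.Fubini'[symmetric]) (rule F)
  also have "\<dots> = (\<integral>\<^sup>+y. (\<integral>\<^sup>+x. ennreal (w x * norm (heat_kernel \<nu> t (x - y))) \<partial>lborel) * ennreal (norm (\<phi> y)) \<partial>lborel)"
    unfolding F_def by (intro nn_integral_cong nn_integral_multc) measurable
  finally show ?thesis .
qed

lemma nn_integral_lborel_shift:
  fixes y :: "real ^ 'n::finite"
  assumes [measurable]: "F \<in> borel_measurable borel"
  shows "(\<integral>\<^sup>+x. F (x - y) \<partial>lborel) = (\<integral>\<^sup>+z. F z \<partial>lborel)"
proof -
  have "(\<integral>\<^sup>+z. F z \<partial>lborel) = (\<integral>\<^sup>+z. F z \<partial>distr lborel borel ((+) (- y)))"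
    by (simp only: lborel_distr_plus)
  also have "\<dots> = (\<integral>\<^sup>+x. F (x - y) \<partial>lborel)" by (subst nn_integral_distr) auto
  finally show ?thesis ..
qed

text \<open>The moments of orders 0, m and m + 1 share one constant, uniform in \<tau>,
  \<open>w\<close>, \<open>y\<close> and the coefficients. Order m + 1 comes from the tail weights,
  where an extra factor \<open>(norm y + norm (x - y)) / R\<close> is inserted. The lower bound 1 on
  \<open>c\<close> is what later makes the constant \<open>C\<close> of the Gronwall argument at
  least 1.\<close>

lemma heat_kernel_weight_le:
  assumes \<nu>: "0 < Re \<nu>"
  obtains c where "1 \<le> c"
    "\<And>\<tau> w (y :: real ^ 'n::finite) a\<^sub>0 a\<^sub>1 a\<^sub>2.
       \<lbrakk>0 < \<tau>; 0 \<le> a\<^sub>0; 0 \<le> a\<^sub>1; 0 \<le> a\<^sub>2;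
        \<And>x. w x \<le> a\<^sub>0 + a\<^sub>1 * norm (x - y) ^ m + a\<^sub>2 * norm (x - y) ^ Suc m\<rbrakk>
       \<Longrightarrow> (\<integral>\<^sup>+x. ennreal (w x * norm (heat_kernel \<nu> \<tau> (x - y))) \<partial>lborel)
           \<le> ennreal (c * (a\<^sub>0 + a\<^sub>1 * sqrt \<tau> ^ m + a\<^sub>2 * sqrt \<tau> ^ Suc m))"
proof -
  have "\<forall>k. \<exists>c\<ge>0. \<forall>\<tau>>0. (\<integral>\<^sup>+z. ennreal (norm z ^ k * norm (heat_kernel \<nu> \<tau> (z :: real ^ 'n))) \<partial>lborel)
    \<le> ennreal (c * sqrt \<tau> ^ k)"
    using heat_kernel_moment[OF \<nu>] by blast
  then obtain c where c0: "\<And>k. 0 \<le> c k" and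
    c: "\<And>k \<tau>. 0 < \<tau> \<Longrightarrow> (\<integral>\<^sup>+z. ennreal (norm z ^ k * norm (heat_kernel \<nu> \<tau> (z :: real ^ 'n))) \<partial>lborel)
    \<le> ennreal (c k * sqrt \<tau> ^ k)"
    by metis
  define d where "d = 1 + c 0 + c m + c (Suc m)"
  have d: "c 0 \<le> d" "c m \<le> d" "c (Suc m) \<le> d" "1 \<le> d"
    using c0[of 0] c0[of m] c0[of "Suc m"] by (auto simp: d_def)
  show ?thesis
  proof (rule that[OF d(4)])
    fix \<tau> a\<^sub>0 a\<^sub>1 a\<^sub>2 :: real and w and y :: "real ^ 'n"
    assume \<tau>: "0 < \<tau>" and a: "0 \<le> a\<^sub>0" "0 \<le> a\<^sub>1" "0 \<le> a\<^sub>2"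
      and w: "\<And>x. w x \<le> a\<^sub>0 + a\<^sub>1 * norm (x - y) ^ m + a\<^sub>2 * norm (x - y) ^ Suc m"
    define G where "G k z = ennreal (norm z ^ k * norm (heat_kernel \<nu> \<tau> z))" for k and z :: "real ^ 'n"
    have G [measurable]: "G k \<in> borel_measurable borel" for k unfolding G_def by measurable
    have "(\<integral>\<^sup>+x. ennreal (w x * norm (heat_kernel \<nu> \<tau> (x - y))) \<partial>lborel)
       \<le> (\<integral>\<^sup>+x. ennreal a\<^sub>0 * G 0 (x - y) + ennreal a\<^sub>1 * G m (x - y) + ennreal a\<^sub>2 * G (Suc m) (x - y) \<partial>lborel)"
    proof (rule nn_integral_mono)
      fix x
      have "w x * norm (heat_kernel \<nu> \<tau> (x - y))
         \<le> (a\<^sub>0 + a\<^sub>1 * norm (x - y) ^ m + a\<^sub>2 * norm (x - y) ^ Suc m) * norm (heat_kernel \<nu> \<tau> (x - y))"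
        by (intro mult_right_mono w) auto
      then have "ennreal (w x * norm (heat_kernel \<nu> \<tau> (x - y))) \<le>
         ennreal (a\<^sub>0 * (norm (x - y) ^ 0 * norm (heat_kernel \<nu> \<tau> (x - y)))
           + a\<^sub>1 * (norm (x - y) ^ m * norm (heat_kernel \<nu> \<tau> (x - y)))
           + a\<^sub>2 * (norm (x - y) ^ Suc m * norm (heat_kernel \<nu> \<tau> (x - y))))"
        by (intro ennreal_leI) (simp add: algebra_simps)
      also have "\<dots> = ennreal a\<^sub>0 * G 0 (x - y) + ennreal a\<^sub>1 * G m (x - y) + ennreal a\<^sub>2 * G (Suc m) (x - y)"
        unfolding G_def using a
        by (subst ennreal_plus, simp, simp)+ (simp only: ennreal_mult' ennreal_mult)
      finally show "ennreal (w x * norm (heat_kernel \<nu> \<tau> (x - y)))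
        \<le> ennreal a\<^sub>0 * G 0 (x - y) + ennreal a\<^sub>1 * G m (x - y) + ennreal a\<^sub>2 * G (Suc m) (x - y)" .
    qed
    also have "\<dots> = ennreal a\<^sub>0 * (\<integral>\<^sup>+z. G 0 z \<partial>lborel) + ennreal a\<^sub>1 * (\<integral>\<^sup>+z. G m z \<partial>lborel) + ennreal a\<^sub>2 * (\<integral>\<^sup>+z. G (Suc m) z \<partial>lborel)"
      by (simp add: nn_integral_add nn_integral_cmult nn_integral_lborel_shift)
    also have "\<dots> \<le> ennreal a\<^sub>0 * ennreal (d * sqrt \<tau> ^ 0) + ennreal a\<^sub>1 * ennreal (d * sqrt \<tau> ^ m) + ennreal a\<^sub>2 * ennreal (d * sqrt \<tau> ^ Suc m)"
      unfolding G_def using \<tau> d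
      by (intro add_mono mult_left_mono order_trans[OF c[OF \<tau>]] ennreal_leI mult_right_mono) auto
    also have "\<dots> = ennreal (d * (a\<^sub>0 + a\<^sub>1 * sqrt \<tau> ^ m + a\<^sub>2 * sqrt \<tau> ^ Suc m))"
      using a d(4) \<tau> by (simp add: algebra_simps flip: ennreal_mult ennreal_plus)
    finally show "(\<integral>\<^sup>+x. ennreal (w x * norm (heat_kernel \<nu> \<tau> (x - y))) \<partial>lborel)
       \<le> ennreal (d * (a\<^sub>0 + a\<^sub>1 * sqrt \<tau> ^ m + a\<^sub>2 * sqrt \<tau> ^ Suc m))" .
  qed
qed

section \<open>Capped distance to a ball, the source of the bounded weights\<close>

definition cutoff_excess :: "real \<Rightarrow> real \<Rightarrow> 'a::real_normed_vector \<Rightarrow> real" where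
  "cutoff_excess R L x = min (max (norm x - R) 0) L"

lemma cutoff_excess_measurable [measurable]:
  "cutoff_excess R L \<in> borel_measurable (borel :: ('a::euclidean_space) measure)"
  unfolding cutoff_excess_def by measurable

lemma cutoff_excess_nonneg: "0 \<le> L \<Longrightarrow> 0 \<le> cutoff_excess R L x"
  and cutoff_excess_le: "cutoff_excess R L x \<le> L"
  by (auto simp: cutoff_excess_def)

text \<open>The norm has Lipschitz constant 1, and clipping at 0 and at \<open>L\<close> cannot
  increase it.\<close>

lemma cutoff_excess_triangle:
  "0 \<le> L \<Longrightarrow> cutoff_excess R L x \<le> norm (x - y) + cutoff_excess R L y"
  using norm_triangle_sub[of x y] norm_ge_zero[of "x - y"]
  unfolding cutoff_excess_def by linarith

lemma power_add_le:
  fixes a b :: real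
  assumes "0 \<le> a" "0 \<le> b"
  shows "(a + b) ^ m \<le> 2 ^ m * (a ^ m + b ^ m)"
proof -
  have "(a + b) ^ m \<le> (2 * max a b) ^ m" using assms by (intro power_mono) auto
  also have "\<dots> \<le> 2 ^ m * (a ^ m + b ^ m)"
    using assms by (auto simp: power_mult_distrib max_def)
  finally show ?thesis .
qed

lemma cutoff_excess_power_le:
  assumes "0 \<le> L"
  shows "cutoff_excess R L x ^ m \<le> 2 ^ m * (norm (x - y) ^ m + cutoff_excess R L y ^ m)"
proof -
  have "cutoff_excess R L x ^ m \<le> (norm (x - y) + cutoff_excess R L y) ^ m"
    by (intro power_mono cutoff_excess_triangle cutoff_excess_nonneg assms)
  also have "\<dots> \<le> 2 ^ m * (norm (x - y) ^ m + cutoff_excess R L y ^ m)"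
    by (intro power_add_le cutoff_excess_nonneg assms norm_ge_zero)
  finally show ?thesis .
qed

text \<open>
  Where the left-hand side does not vanish, \<open>R < norm x \<le> norm (x - y) + norm y\<close>, which makes the
  error term in the following lemma small for large \<open>R\<close>.
\<close>

lemma cutoff_excess_power_le_divide:
  assumes "0 \<le> L" "0 < R" "0 < m"
  shows "cutoff_excess R L x ^ m
    \<le> 2 ^ m * (norm (x - y) ^ m * (norm y + norm (x - y)) / R + cutoff_excess R L y ^ m)"
proof (cases "norm x \<le> R")
  case True
  then have *: "cutoff_excess R L x ^ m = 0" using assms by (simp add: cutoff_excess_def)
  show ?thesis unfolding * using assms cutoff_excess_nonneg[of L R y] by simp
next
  case False
  then have "R \<le> norm y + norm (x - y)" using norm_triangle_sub[of x y] by auto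
  then have "1 \<le> (norm y + norm (x - y)) / R" using assms by (simp add: field_simps)
  then have "norm (x - y) ^ m * 1 \<le> norm (x - y) ^ m * ((norm y + norm (x - y)) / R)"
    by (intro mult_left_mono) auto
  then show ?thesis
    using cutoff_excess_power_le[OF assms(1), of R x m y]
    by (auto elim!: order_trans intro!: mult_left_mono)
qed

section \<open>Gronwall's inequality and weighted bounds for mild solutions\<close>

lemma gronwall_integral:
  fixes G a :: "real \<Rightarrow> real"
  assumes G: "continuous_on {0..T} G" and a: "continuous_on {0..T} a"
    and a0: "\<And>s. s \<in> {0..T} \<Longrightarrow> 0 \<le> a s"
    and le: "\<And>t. 0 < t \<Longrightarrow> t \<le> T \<Longrightarrow> G t \<le> B + integral {0..t} (\<lambda>s. a s * G s)"
    and t: "0 < t" "t \<le> T"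
  shows "G t \<le> B * exp (integral {0..t} a)"
proof -
  define F where "F t = integral {0..t} (\<lambda>s. a s * G s)" for t
  define A where "A t = integral {0..t} a" for t
  \<comment> \<open>Integrating factor: \<open>H\<close> starts at \<open>B\<close>, and
    \<open>le\<close> makes its derivative nonpositive. As \<open>le\<close> concerns positive
    times, the sign is examined on the open interval and continuity takes care of the endpoint
    0.\<close>
  define H where "H t = (B + F t) * exp (- A t)" for t
  have F': "(F has_real_derivative a s * G s) (at s within {0..T})" if "s \<in> {0..T}" for s
    unfolding F_def by (rule integral_has_real_derivative) (use that G a in \<open>auto intro!: continuous_intros\<close>)
  have A': "(A has_real_derivative a s) (at s within {0..T})" if "s \<in> {0..T}" for s
    unfolding A_def by (rule integral_has_real_derivative) (use that a in auto)
  have H': "(H has_real_derivative (a s * G s - a s * (B + F s)) * exp (- A s)) (at s within {0..T})"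
    if "s \<in> {0..T}" for s
    unfolding H_def by (rule derivative_eq_intros F'[OF that] A'[OF that] refl)+ (simp add: algebra_simps)
  have "H t \<le> H 0"
  proof (rule DERIV_nonpos_imp_decreasing_open[where f = H and a = 0 and b = t])
    show "0 \<le> t" using t by simp
    show "continuous_on {0..t} H"
      using t by (intro continuous_on_subset[OF DERIV_continuous_on[OF H']]) auto
    fix s assume s: "0 < s" "s < t"
    then have "at s within {0..T} = at s" using t by (intro at_within_Icc_at) auto
    then have "(H has_real_derivative (a s * G s - a s * (B + F s)) * exp (- A s)) (at s)"
      using H'[of s] s t by auto
    moreover have "a s * G s \<le> a s * (B + F s)"
      using le[of s] a0[of s] s t unfolding F_def by (intro mult_left_mono) auto
    then have "(a s * G s - a s * (B + F s)) * exp (- A s) \<le> 0"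
      by (intro mult_nonpos_nonneg) auto
    ultimately show "\<exists>y. (H has_real_derivative y) (at s) \<and> y \<le> 0" by blast
  qed
  then have "(B + F t) * exp (- A t) \<le> B" by (simp add: H_def F_def A_def)
  then have "B + F t \<le> B * exp (A t)" by (simp add: exp_minus field_simps)
  then show ?thesis using le[OF t] by (simp add: F_def A_def)
qed

lemma weighted_norm_finite:
  assumes "\<phi> \<in> Lp 1" "\<And>x. 0 \<le> w x" "\<And>x. w x \<le> L"
  shows "weighted_norm w \<phi> < \<infinity>"
proof -
  have "weighted_norm w \<phi> \<le> ennreal L * Lp_norm 1 \<phi>"
    using assms by (intro weighted_norm_le_Lp_norm_1) (auto simp: Lp_def)
  also have "\<dots> < \<infinity>" using assms(1) by (auto simp: Lp_def ennreal_mult_less_top)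
  finally show ?thesis .
qed

text \<open>Prepares Gronwall's inequality, which is for continuous real functions. The reverse
  triangle inequality and the bound on \<open>w\<close> control increments by \<open>L\<close> times
  the L1 distance; finiteness keeps \<open>enn2real\<close> faithful.\<close>

lemma continuous_on_weighted_norm:
  assumes u: "u \<in> cont_into S (Lp 1) (Lp_norm 1)"
    and w: "w \<in> borel_measurable borel" "\<And>x. 0 \<le> w x" "\<And>x. w x \<le> L"
  shows "continuous_on S (\<lambda>t. enn2real (weighted_norm w (u t)))"
  unfolding continuous_on
proof
  fix t assume t: "t \<in> S"
  have u1: "\<And>s. s \<in> S \<Longrightarrow> u s \<in> Lp 1"
    and lim: "((\<lambda>s. Lp_norm 1 (\<lambda>x. u s x - u t x)) \<longlongrightarrow> 0) (at t within S)"
    using u t by (auto simp: cont_into_def)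
  have [measurable]: "u s \<in> borel_measurable borel" if "s \<in> S" for s using u1[OF that] by (auto simp: Lp_def)
  define d where "d s = weighted_norm w (\<lambda>x. u s x - u t x)" for s
  have dt: "d s < \<infinity>" if "s \<in> S" for s
    unfolding d_def using u1 that t w
    by (intro weighted_norm_finite[where L=L]) (auto simp: Lp_1_iff_integrable)
  have "((\<lambda>s. ennreal L * Lp_norm 1 (\<lambda>x. u s x - u t x)) \<longlongrightarrow> ennreal L * 0) (at t within S)"
    by (intro ennreal_tendsto_cmult lim) auto
  then have lim': "((\<lambda>s. ennreal L * Lp_norm 1 (\<lambda>x. u s x - u t x)) \<longlongrightarrow> 0) (at t within S)"
    by simp
  have "(d \<longlongrightarrow> 0) (at t within S)"
  proof (rule tendsto_sandwich[OF _ _ tendsto_const lim'])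
    show "\<forall>\<^sub>F s in at t within S. d s \<le> ennreal L * Lp_norm 1 (\<lambda>x. u s x - u t x)"
      unfolding d_def eventually_at_filter using w t
      by (intro always_eventually allI impI weighted_norm_le_Lp_norm_1) auto
  qed auto
  then have d0: "((\<lambda>s. enn2real (d s)) \<longlongrightarrow> 0) (at t within S)"
    using tendsto_enn2real[of d 0] by simp
  have "((\<lambda>s. enn2real (weighted_norm w (u s)) - enn2real (weighted_norm w (u t))) \<longlongrightarrow> 0) (at t within S)"
  proof (rule Lim_null_comparison[OF _ d0])
    show "\<forall>\<^sub>F s in at t within S. norm (enn2real (weighted_norm w (u s)) - enn2real (weighted_norm w (u t))) \<le> enn2real (d s)"
      unfolding eventually_at_filter
    proof (intro always_eventually allI impI)
      fix s assume s: "s \<in> S"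
      have fin: "weighted_norm w (u s) < \<infinity>" "weighted_norm w (u t) < \<infinity>"
        using weighted_norm_finite[OF u1[OF s] w(2,3)] weighted_norm_finite[OF u1[OF t] w(2,3)] by auto
      have "weighted_norm w (u s) \<le> weighted_norm w (u t) + d s"
        unfolding d_def using s t w by (intro weighted_norm_triangle norm_triangle_sub) auto
      then have 1: "enn2real (weighted_norm w (u s)) \<le> enn2real (weighted_norm w (u t)) + enn2real (d s)"
        using fin dt[OF s] by (subst enn2real_plus[symmetric]) (auto intro!: enn2real_mono simp: less_top)
      have "weighted_norm w (u t) \<le> weighted_norm w (u s) + d s"
        unfolding d_def using s t w norm_triangle_sub[of "u t x" "u s x" for x]
        by (intro weighted_norm_triangle) (auto simp: norm_minus_commute)
      then have 2: "enn2real (weighted_norm w (u t)) \<le> enn2real (weighted_norm w (u s)) + enn2real (d s)"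
        using fin dt[OF s] by (subst enn2real_plus[symmetric]) (auto intro!: enn2real_mono simp: less_top)
      show "norm (enn2real (weighted_norm w (u s)) - enn2real (weighted_norm w (u t))) \<le> enn2real (d s)"
        using 1 2 by auto
    qed
  qed
  then show "((\<lambda>s. enn2real (weighted_norm w (u s))) \<longlongrightarrow> enn2real (weighted_norm w (u t))) (at t within S)"
    by (rule LIM_zero_cancel)
qed

text \<open>In \<open>ker\<close> the term \<open>C * w y\<close> reproduces the weight itself and
  will be closed by Gronwall's inequality; \<beta> collects the mass that diffusion carries to where
  \<open>w\<close> is larger, for instance from points where \<open>w\<close> vanishes.\<close>

lemma weighted_norm_heat_semigroup_le_add:
  fixes \<phi> :: "real ^ 'n::finite \<Rightarrow> complex"
  assumes t: "0 < t" and \<phi> [measurable]: "\<phi> \<in> borel_measurable borel"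
    and w [measurable]: "w \<in> borel_measurable borel" and w0: "\<And>x. 0 \<le> w x"
    and \<beta> [measurable]: "\<beta> \<in> borel_measurable borel" and \<beta>0: "\<And>x. 0 \<le> \<beta> x" and C: "0 \<le> C"
    and ker: "\<And>y. (\<integral>\<^sup>+x. ennreal (w x * norm (heat_kernel \<nu> t (x - y))) \<partial>lborel) \<le> ennreal (C * w y + \<beta> y)"
  shows "weighted_norm w (heat_semigroup \<nu> t \<phi>) \<le> ennreal C * weighted_norm w \<phi> + weighted_norm \<beta> \<phi>"
proof -
  have "weighted_norm w (heat_semigroup \<nu> t \<phi>)
    \<le> (\<integral>\<^sup>+y. (\<integral>\<^sup>+x. ennreal (w x * norm (heat_kernel \<nu> t (x - y))) \<partial>lborel) * ennreal (norm (\<phi> y)) \<partial>lborel)"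
    by (intro weighted_norm_heat_semigroup_le assms)
  also have "\<dots> \<le> (\<integral>\<^sup>+y. ennreal C * ennreal (w y * norm (\<phi> y)) + ennreal (\<beta> y * norm (\<phi> y)) \<partial>lborel)"
  proof (rule nn_integral_mono)
    fix y
    have "(\<integral>\<^sup>+x. ennreal (w x * norm (heat_kernel \<nu> t (x - y))) \<partial>lborel) * ennreal (norm (\<phi> y))
       \<le> ennreal (C * w y + \<beta> y) * ennreal (norm (\<phi> y))"
      by (intro mult_right_mono ker) auto
    also have "\<dots> = ennreal C * ennreal (w y * norm (\<phi> y)) + ennreal (\<beta> y * norm (\<phi> y))"
      using C w0[of y] \<beta>0[of y] by (simp add: algebra_simps flip: ennreal_mult ennreal_plus)
    finally show "(\<integral>\<^sup>+x. ennreal (w x * norm (heat_kernel \<nu> t (x - y))) \<partial>lborel) * ennreal (norm (\<phi> y))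
       \<le> ennreal C * ennreal (w y * norm (\<phi> y)) + ennreal (\<beta> y * norm (\<phi> y))" .
  qed
  also have "\<dots> = ennreal C * weighted_norm w \<phi> + weighted_norm \<beta> \<phi>"
    unfolding weighted_norm_def by (simp add: nn_integral_add nn_integral_cmult)
  finally show ?thesis .
qed

lemma weighted_norm_le_cmult_AE:
  assumes "AE x in lborel. norm (\<psi> x) \<le> a * norm (\<phi> x)" "0 \<le> a" "\<And>x. 0 \<le> w x"
    and [measurable]: "w \<in> borel_measurable borel" "\<phi> \<in> borel_measurable borel"
  shows "weighted_norm w \<psi> \<le> ennreal a * weighted_norm w \<phi>"
proof -
  have "weighted_norm w \<psi> \<le> (\<integral>\<^sup>+x. ennreal a * ennreal (w x * norm (\<phi> x)) \<partial>lborel)"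
    unfolding weighted_norm_def
  proof (rule nn_integral_mono_AE)
    show "AE x in lborel. ennreal (w x * norm (\<psi> x)) \<le> ennreal a * ennreal (w x * norm (\<phi> x))"
      using assms(1)
    proof eventually_elim
      case (elim x)
      have "w x * norm (\<psi> x) \<le> a * (w x * norm (\<phi> x))"
        using mult_left_mono[OF elim assms(3)[of x]] by (simp add: mult_ac)
      then show ?case using assms(2,3) by (simp add: ennreal_leI flip: ennreal_mult)
    qed
  qed
  also have "\<dots> = ennreal a * weighted_norm w \<phi>"
    unfolding weighted_norm_def by (intro nn_integral_cmult) auto
  finally show ?thesis .
qed

text \<open>Duhamel's formula yields a nonnegative Lebesgue integral over the open interval,
  Gronwall's inequality uses the gauge integral over the closed one; this connects the two.\<close>

lemma nn_integral_restrict_Ioo_le_integral: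
  fixes h :: "real \<Rightarrow> real"
  assumes h: "continuous_on {0..t} h" and h0: "\<And>s. s \<in> {0..t} \<Longrightarrow> 0 \<le> h s"
  shows "(\<integral>\<^sup>+s. ennreal (h s) \<partial>restrict_space lborel {0<..<t}) \<le> ennreal (integral {0..t} h)"
proof -
  have si: "set_integrable lborel {0..t} h" using h by (rule borel_integrable_atLeastAtMost')
  have "(\<integral>\<^sup>+s. ennreal (h s) \<partial>restrict_space lborel {0<..<t}) \<le> (\<integral>\<^sup>+s. ennreal (indicator {0..t} s *\<^sub>R h s) \<partial>lborel)"
    by (subst nn_integral_restrict_space) (auto intro!: nn_integral_mono split: split_indicator)
  also have "\<dots> = ennreal (LINT s:{0..t}|lborel. h s)"
    unfolding set_lebesgue_integral_def using si h0
    by (intro nn_integral_eq_integral) (auto simp: set_integrable_def split: split_indicator)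
  also have "(LINT s:{0..t}|lborel. h s) = integral {0..t} h"
    using si by (rule set_borel_integral_eq_integral)
  finally show ?thesis .
qed

text \<open>With \<open>g s\<close> the weighted norm of \<open>u s\<close>, Duhamel's formula and
  the kernel bound give an integral inequality that Gronwall's lemma closes. The cap
  \<open>L\<close> enters only qualitatively, through finiteness, continuity and the passage to the
  Bochner integral, so it can be sent to infinity afterwards. Bounding the total integral of
  \<open>a\<close> by \<open>J\<close> keeps the exponential factor independent of
  \<open>T\<close>.\<close>

lemma weighted_norm_mild_solution_le:
  fixes u :: "real \<Rightarrow> real ^ 'n::finite \<Rightarrow> complex"
  assumes sol: "global_mild_solution \<nu> f u\<^sub>0 u"
    and u0 [measurable]: "u\<^sub>0 \<in> borel_measurable borel" and f [measurable]: "f \<in> borel_measurable borel"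
    and a: "continuous_on {0..} a" "\<And>s. 0 \<le> a s" "\<And>t. 0 \<le> t \<Longrightarrow> integral {0..t} a \<le> J"
    and fa: "AE s in lborel. 0 < s \<longrightarrow> (AE x in lborel. norm (f (u s x)) \<le> a s * norm (u s x))"
    and w [measurable]: "w \<in> borel_measurable borel" and w0: "\<And>x. 0 \<le> w x" and wL: "\<And>x. w x \<le> L"
    and \<beta> [measurable]: "\<beta> \<in> borel_measurable borel" and \<beta>0: "\<And>x. 0 \<le> \<beta> x" and C: "1 \<le> C"
    and ker: "\<And>\<tau> y. 0 < \<tau> \<Longrightarrow> \<tau> \<le> T \<Longrightarrow> (\<integral>\<^sup>+x. ennreal (w x * norm (heat_kernel \<nu> \<tau> (x - y))) \<partial>lborel) \<le> ennreal (C * w y + \<beta> y)"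
    and B: "0 \<le> B" "weighted_norm \<beta> u\<^sub>0 \<le> ennreal B" "\<And>s. 0 < s \<Longrightarrow> s \<le> T \<Longrightarrow> weighted_norm \<beta> (u s) \<le> ennreal B"
    and Q: "0 \<le> Q" "weighted_norm w u\<^sub>0 \<le> ennreal Q"
    and T: "0 < T" and t: "0 \<le> t" "t \<le> T"
  shows "weighted_norm w (u t) \<le> ennreal ((C * (C * Q + B) + B) * exp (C * J))"
proof -
  have uc: "u \<in> cont_into {0..} (Lp 1) (Lp_norm 1)"
    using sol by (auto simp: global_mild_solution_def solution_space_def bdd_cont_into_def)
  have u1: "u s \<in> Lp 1" if "0 \<le> s" for s using uc that by (auto simp: cont_into_def)
  have um: "u s \<in> borel_measurable borel" if "0 \<le> s" for s using u1[OF that] by (auto simp: Lp_def)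
  define g where "g s = enn2real (weighted_norm w (u s))" for s
  have gc: "continuous_on {0..} g"
    unfolding g_def using uc w w0 wL by (rule continuous_on_weighted_norm)
  have g: "weighted_norm w (u s) = ennreal (g s)" if "0 \<le> s" for s
    unfolding g_def using weighted_norm_finite[OF u1[OF that] w0 wL] by (simp add: less_top)
  have g0: "0 \<le> g s" for s by (simp add: g_def)
  have step: "g t \<le> (C * Q + B) + integral {0..t} (\<lambda>s. a s * (C * g s + B))" if t: "0 < t" "t \<le> T" for t
  proof -
    let ?M = "restrict_space lborel {0<..<t}"
    define h where "h s = a s * (C * g s + B)" for s
    have hc: "continuous_on {0..t} h" unfolding h_def
      by (intro continuous_intros continuous_on_subset[OF gc] continuous_on_subset[OF a(1)]) auto
    have h0: "0 \<le> h s" for s unfolding h_def using a(2) g0 B(1) C by auto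
    define v where "v = (\<lambda>x. u t x - heat_semigroup \<nu> t u\<^sub>0 x)"
    have int: "has_bochner_integral_in (Lp 1 \<inter> Lp \<infinity>) L1_Linf_norm ?M
        (\<lambda>s. heat_semigroup \<nu> (t - s) (\<lambda>x. f (u s x))) v"
      using sol t by (auto simp: global_mild_solution_def v_def)
    have vm: "v \<in> borel_measurable borel" using int by (auto simp: has_bochner_integral_in_def Lp_def)
    \<comment> \<open>Measurability is read off from \<open>u t\<close> and \<open>v\<close>, whose
      difference this function is, instead of from the convolution formula.\<close>
    have hm: "heat_semigroup \<nu> t u\<^sub>0 \<in> borel_measurable borel"
      using borel_measurable_diff[OF um[of t] vm] t by (simp add: v_def)
    have "emeasure ?M (space ?M) \<noteq> \<infinity>"
      using t by (simp add: emeasure_restrict_space space_restrict_space)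
    then have fin: "finite_measure ?M" by (rule finite_measureI)
    have "{0<..<t} \<subseteq> {0..t}" by auto
    then have "h \<in> borel_measurable (restrict_space borel {0<..<t})"
      using hc by (intro borel_measurable_continuous_on_restrict continuous_on_subset[OF hc])
    then have hM: "(\<lambda>s. ennreal (h s)) \<in> borel_measurable ?M"
      by (simp add: measurable_cong_sets[OF sets_restrict_space_cong[OF sets_lborel] refl])
    have "weighted_norm w v \<le> (\<integral>\<^sup>+s. ennreal (h s) \<partial>?M)"
    proof (rule weighted_norm_bochner_le[OF fin int w w0 wL hM])
      have "AE s in lborel. s \<in> {0<..<t} \<longrightarrow> weighted_norm w (heat_semigroup \<nu> (t - s) (\<lambda>x. f (u s x))) \<le> ennreal (h s)"
        using fa
      proof eventually_elim
        case (elim s)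
        show ?case
        proof
          assume "s \<in> {0<..<t}"
          then have s: "0 < s" "s < t" by auto
          have [measurable]: "u s \<in> borel_measurable borel" using um s by simp
          have "weighted_norm w (heat_semigroup \<nu> (t - s) (\<lambda>x. f (u s x)))
             \<le> ennreal C * weighted_norm w (\<lambda>x. f (u s x)) + weighted_norm \<beta> (\<lambda>x. f (u s x))"
            using s t C by (intro weighted_norm_heat_semigroup_le_add w0 \<beta>0 ker) auto
          also have "\<dots> \<le> ennreal C * (ennreal (a s) * weighted_norm w (u s)) + ennreal (a s) * weighted_norm \<beta> (u s)"
            using elim s a(2) w0 \<beta>0 by (intro add_mono mult_left_mono weighted_norm_le_cmult_AE) auto
          also have "\<dots> \<le> ennreal C * (ennreal (a s) * ennreal (g s)) + ennreal (a s) * ennreal B"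
            using s t by (intro add_mono mult_left_mono B(3)) (auto simp: g)
          also have "\<dots> = ennreal (h s)"
            using C a(2) g0 B(1) by (simp add: h_def algebra_simps flip: ennreal_mult ennreal_plus)
          finally show "weighted_norm w (heat_semigroup \<nu> (t - s) (\<lambda>x. f (u s x))) \<le> ennreal (h s)" .
        qed
      qed
      then show "AE s in ?M. weighted_norm w (heat_semigroup \<nu> (t - s) (\<lambda>x. f (u s x))) \<le> ennreal (h s)"
        by (subst AE_restrict_space_iff) auto
    qed
    also have "\<dots> \<le> ennreal (integral {0..t} h)"
      using hc h0 by (intro nn_integral_restrict_Ioo_le_integral)
    finally have 1: "weighted_norm w v \<le> ennreal (integral {0..t} h)" .
    have "weighted_norm w (heat_semigroup \<nu> t u\<^sub>0) \<le> ennreal C * weighted_norm w u\<^sub>0 + weighted_norm \<beta> u\<^sub>0"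
      using t C by (intro weighted_norm_heat_semigroup_le_add w0 \<beta>0 ker) auto
    also have "\<dots> \<le> ennreal C * ennreal Q + ennreal B"
      using Q B by (intro add_mono mult_left_mono) auto
    also have "\<dots> = ennreal (C * Q + B)"
      using C Q B by (simp flip: ennreal_mult ennreal_plus)
    finally have 2: "weighted_norm w (heat_semigroup \<nu> t u\<^sub>0) \<le> ennreal (C * Q + B)" .
    have "norm (u t x) \<le> norm (heat_semigroup \<nu> t u\<^sub>0 x) + norm (v x)" for x
      using norm_triangle_ineq[of "heat_semigroup \<nu> t u\<^sub>0 x" "v x"] by (simp add: v_def)
    then have "weighted_norm w (u t) \<le> weighted_norm w (heat_semigroup \<nu> t u\<^sub>0) + weighted_norm w v"
      using w w0 hm vm by (intro weighted_norm_triangle)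
    also have "\<dots> \<le> ennreal (C * Q + B) + ennreal (integral {0..t} h)" by (intro add_mono 1 2)
    also have "\<dots> = ennreal ((C * Q + B) + integral {0..t} h)"
      using C Q B h0 hc by (subst ennreal_plus) (auto intro!: Henstock_Kurzweil_Integration.integral_nonneg integrable_continuous_interval)
    finally have "ennreal (g t) \<le> ennreal ((C * Q + B) + integral {0..t} h)" using t by (simp add: g)
    moreover have "0 \<le> (C * Q + B) + integral {0..t} h"
      using C Q(1) B(1) h0 hc
      by (intro add_nonneg_nonneg Henstock_Kurzweil_Integration.integral_nonneg integrable_continuous_interval) auto
    ultimately show ?thesis unfolding h_def[symmetric] by (simp only: ennreal_le_iff)
  qed
  have main: "g t \<le> (C * (C * Q + B) + B) * exp (C * J)" if t: "0 < t" "t \<le> T" for t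
  proof -
    \<comment> \<open>Gronwall's inequality is applied to \<open>C * g s + B\<close> because this
      combination stands under the integral in \<open>step\<close>: multiplying \<open>step\<close>
      by \<open>C\<close> and adding \<open>B\<close> reproduces it on the left. It dominates
      \<open>g\<close> since \<open>C\<close> is at least 1 and \<open>B\<close> is
      nonnegative.\<close>
    define G where "G s = C * g s + B" for s
    have "G t \<le> (C * (C * Q + B) + B) * exp (integral {0..t} (\<lambda>s. C * a s))"
    proof (rule gronwall_integral[of T])
      show "continuous_on {0..T} G" "continuous_on {0..T} (\<lambda>s. C * a s)"
        unfolding G_def
        by (intro continuous_intros continuous_on_subset[OF gc] continuous_on_subset[OF a(1)]; auto)+
      show "0 \<le> C * a s" for s using C a(2) by simp
      show "0 < t" "t \<le> T" by (fact t)+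
      fix r assume r: "0 < r" "r \<le> T"
      have "G r \<le> C * ((C * Q + B) + integral {0..r} (\<lambda>s. a s * G s)) + B"
        unfolding G_def using C step[OF r] by (intro add_right_mono mult_left_mono) auto
      then show "G r \<le> (C * (C * Q + B) + B) + integral {0..r} (\<lambda>s. C * a s * G s)"
        by (simp add: algebra_simps)
    qed
    also have "\<dots> \<le> (C * (C * Q + B) + B) * exp (C * J)"
      using a(3)[of t] t C Q(1) B(1) by (intro mult_left_mono) auto
    also have "g t \<le> G t" unfolding G_def
      using mult_right_mono[OF C g0[of t]] B(1) by simp
    finally show ?thesis by simp
  qed
  \<comment> \<open>The equation is only given for \<open>t > 0\<close>; passing to the limit covers \<open>t = 0\<close> without showing that
    \<open>u 0 = u\<^sub>0\<close> almost everywhere.\<close>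
  have cl: "closure {0<..<T} = {0..T}" using T by simp
  have "g t \<le> (C * (C * Q + B) + B) * exp (C * J)"
    by (rule continuous_le_on_closure[of "{0<..<T}" g]) (use cl t main in \<open>auto intro: continuous_on_subset[OF gc]\<close>)
  then show ?thesis using t by (simp add: g ennreal_leI)
qed

section \<open>Removing the cap, and vanishing of the tails\<close>

definition excess :: "real \<Rightarrow> 'a::real_normed_vector \<Rightarrow> real" where
  "excess R x = max (norm x - R) 0"

lemma excess_measurable [measurable]:
  "excess R \<in> borel_measurable (borel :: ('a::euclidean_space) measure)"
  unfolding excess_def by measurable

lemma excess_nonneg [simp]: "0 \<le> excess R x"
  by (simp add: excess_def)

lemma excess_0 [simp]: "excess 0 x = norm x"
  by (simp add: excess_def)

lemma weighted_norm_mono: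
  assumes "\<And>x. v x \<le> w x"
  shows "weighted_norm v \<phi> \<le> weighted_norm w \<phi>"
  unfolding weighted_norm_def using assms by (intro nn_integral_mono ennreal_leI mult_right_mono) auto

lemma weighted_norm_add_cmult:
  assumes [measurable]: "v \<in> borel_measurable borel" "w \<in> borel_measurable borel" "\<phi> \<in> borel_measurable borel"
    and "\<And>x. 0 \<le> v x" "\<And>x. 0 \<le> w x" "0 \<le> a" "0 \<le> b"
  shows "weighted_norm (\<lambda>x. a * v x + b * w x) \<phi> = ennreal a * weighted_norm v \<phi> + ennreal b * weighted_norm w \<phi>"
proof -
  have "weighted_norm (\<lambda>x. a * v x + b * w x) \<phi>
     = (\<integral>\<^sup>+x. ennreal a * ennreal (v x * norm (\<phi> x)) + ennreal b * ennreal (w x * norm (\<phi> x)) \<partial>lborel)"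
    unfolding weighted_norm_def using assms(4-)
    by (intro nn_integral_cong) (simp add: algebra_simps flip: ennreal_mult ennreal_plus)
  then show ?thesis
    by (simp add: nn_integral_add nn_integral_cmult weighted_norm_def)
qed

text \<open>Monotone convergence: as the cap \<open>L\<close> runs through the naturals, the capped
  weights increase and at each point eventually equal the uncapped one.\<close>

lemma weighted_norm_excess_le:
  fixes \<phi> :: "'n::finite cfun"
  assumes [measurable]: "\<phi> \<in> borel_measurable borel"
    and le: "\<And>L. weighted_norm (\<lambda>x. cutoff_excess R (real L) x ^ m) \<phi> \<le> b"
  shows "weighted_norm (\<lambda>x. excess R x ^ m) \<phi> \<le> b"
proof -
  have "(\<lambda>L. weighted_norm (\<lambda>x. cutoff_excess R (real L) x ^ m) \<phi>) \<longlonglongrightarrow> weighted_norm (\<lambda>x. excess R x ^ m) \<phi>"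
    unfolding weighted_norm_def
  proof (rule nn_integral_LIMSEQ)
    show "incseq (\<lambda>L x. ennreal (cutoff_excess R (real L) x ^ m * norm (\<phi> x)))"
      by (auto simp: incseq_def le_fun_def cutoff_excess_def intro!: ennreal_leI mult_right_mono power_mono)
    fix x :: "real ^ 'n"
    obtain N :: nat where N: "norm x - R \<le> real N" using real_arch_simple by blast
    have "\<forall>\<^sub>F L in sequentially. ennreal (cutoff_excess R (real L) x ^ m * norm (\<phi> x)) = ennreal (excess R x ^ m * norm (\<phi> x))"
      using eventually_ge_at_top[of N]
      by eventually_elim (use N in \<open>auto simp: cutoff_excess_def excess_def min_def max_def\<close>)
    then show "(\<lambda>L. ennreal (cutoff_excess R (real L) x ^ m * norm (\<phi> x))) \<longlonglongrightarrow> ennreal (excess R x ^ m * norm (\<phi> x))"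
      by (rule tendsto_eventually)
  qed measurable
  then show ?thesis by (rule LIMSEQ_le_const2) (use le in auto)
qed

text \<open>Dominated convergence with the full moment as majorant: at each \<open>x\<close> the
  excess is 0 once the radius exceeds \<open>norm x\<close>, and so is its m-th power because m >
  0.\<close>

lemma weighted_norm_excess_tendsto_0:
  fixes \<phi> :: "'n::finite cfun"
  assumes [measurable]: "\<phi> \<in> borel_measurable borel" and m: "0 < m"
    and fin: "weighted_norm (\<lambda>x. norm x ^ m) \<phi> < \<infinity>"
  shows "(\<lambda>k. weighted_norm (\<lambda>x. excess (real (Suc k)) x ^ m) \<phi>) \<longlonglongrightarrow> 0"
proof -
  have "(\<lambda>k. weighted_norm (\<lambda>x. excess (real (Suc k)) x ^ m) \<phi>) \<longlonglongrightarrow> (\<integral>\<^sup>+x. 0 \<partial>(lborel :: (real^'n) measure))"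
    unfolding weighted_norm_def
  proof (rule nn_integral_dominated_convergence[where w="\<lambda>x. ennreal (norm x ^ m * norm (\<phi> x))"])
    show "AE x in lborel. ennreal (excess (real (Suc k)) x ^ m * norm (\<phi> x)) \<le> ennreal (norm x ^ m * norm (\<phi> x))" for k
      by (auto simp: excess_def intro!: ennreal_leI mult_right_mono power_mono)
    show "(\<integral>\<^sup>+x. ennreal (norm x ^ m * norm (\<phi> x)) \<partial>lborel) < \<infinity>"
      using fin by (simp add: weighted_norm_def)
    show "AE x in lborel. (\<lambda>k. ennreal (excess (real (Suc k)) x ^ m * norm (\<phi> x))) \<longlonglongrightarrow> 0"
    proof (rule AE_I2)
      fix x :: "real ^ 'n"
      obtain N :: nat where N: "norm x \<le> real N" using real_arch_simple by blast
      have "\<forall>\<^sub>F k in sequentially. ennreal (excess (real (Suc k)) x ^ m * norm (\<phi> x)) = 0"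
        using eventually_ge_at_top[of N]
        by eventually_elim (use N m in \<open>auto simp: excess_def max_def\<close>)
      then show "(\<lambda>k. ennreal (excess (real (Suc k)) x ^ m * norm (\<phi> x))) \<longlonglongrightarrow> 0"
        by (rule tendsto_eventually)
    qed
  qed measurable
  then show ?thesis by simp
qed

section \<open>Monomials versus powers of the Euclidean norm\<close>

lemma abs_mi_prod_le:
  fixes x :: "real ^ 'n::finite"
  shows "\<bar>\<Prod>j\<in>UNIV. (x $ j) ^ \<alpha> j\<bar> \<le> norm x ^ mi_order \<alpha>"
proof -
  have "\<bar>\<Prod>j\<in>UNIV. (x $ j) ^ \<alpha> j\<bar> = (\<Prod>j\<in>UNIV. \<bar>x $ j\<bar> ^ \<alpha> j)" by (simp add: abs_prod power_abs)
  also have "\<dots> \<le> (\<Prod>j\<in>UNIV. norm x ^ \<alpha> j)"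
    by (intro prod_mono) (auto intro!: power_mono component_le_norm_cart)
  also have "\<dots> = norm x ^ mi_order \<alpha>" by (simp add: mi_order_def power_sum)
  finally show ?thesis .
qed

lemma Lp_norm_1_mi_mult:
  "Lp_norm 1 (mi_mult \<alpha> \<phi>) = weighted_norm (\<lambda>x. \<bar>\<Prod>j\<in>UNIV. (x $ j) ^ \<alpha> j\<bar>) \<phi>"
  by (simp add: Lp_norm_1 weighted_norm_def mi_mult_def norm_mult del: of_real_prod of_real_power)

lemma mi_mult_measurable [measurable]:
  "\<phi> \<in> borel_measurable borel \<Longrightarrow> mi_mult \<alpha> \<phi> \<in> borel_measurable borel"
  unfolding mi_mult_def by measurable

lemma power_le_one_add_power:
  fixes r :: real
  assumes "0 \<le> r" "k \<le> m"
  shows "r ^ k \<le> 1 + r ^ m"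
proof (cases "r \<le> 1")
  case True
  then have "r ^ k \<le> 1" using assms by (simp add: power_le_one)
  then show ?thesis using zero_le_power[OF assms(1), of m] by linarith
next
  case False
  then have "r ^ k \<le> r ^ m" using assms by (intro power_increasing) auto
  then show ?thesis by simp
qed

lemma Lp_norm_1_mi_mult_le:
  assumes "mi_order \<alpha> \<le> m"
  shows "Lp_norm 1 (mi_mult \<alpha> \<phi>) \<le> weighted_norm (\<lambda>x. 1 + norm x ^ m) \<phi>"
  unfolding Lp_norm_1_mi_mult
  by (intro weighted_norm_mono order_trans[OF abs_mi_prod_le] power_le_one_add_power assms) auto

text \<open>The Euclidean norm is at most n times the largest component in modulus, and the m-th
  power of that component is one of the summands.\<close>

lemma norm_power_le_sum_component_power:
  fixes x :: "real ^ 'n::finite"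
  shows "norm x ^ m \<le> real CARD('n) ^ m * (\<Sum>i\<in>UNIV. \<bar>x $ i\<bar> ^ m)"
proof -
  define M where "M = Max ((\<lambda>i. \<bar>x $ i\<bar>) ` UNIV)"
  have M: "\<And>i. \<bar>x $ i\<bar> \<le> M" unfolding M_def by auto
  have "M \<in> (\<lambda>i. \<bar>x $ i\<bar>) ` UNIV" unfolding M_def by (intro Max_in) auto
  then obtain i where i: "M = \<bar>x $ i\<bar>" by auto
  have "norm x \<le> (\<Sum>i\<in>UNIV. \<bar>x $ i\<bar>)" by (rule norm_le_l1_cart)
  also have "\<dots> \<le> real CARD('n) * M" using sum_bounded_above[of UNIV "\<lambda>i. \<bar>x $ i\<bar>" M] M by auto
  finally have "norm x ^ m \<le> (real CARD('n) * M) ^ m" by (intro power_mono) auto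
  also have "\<dots> = real CARD('n) ^ m * \<bar>x $ i\<bar> ^ m" by (simp add: i power_mult_distrib)
  also have "\<dots> \<le> real CARD('n) ^ m * (\<Sum>i\<in>UNIV. \<bar>x $ i\<bar> ^ m)"
    by (intro mult_left_mono member_le_sum) auto
  finally show ?thesis .
qed

lemma weighted_norm_finite_L1m:
  fixes \<phi> :: "'n::finite cfun"
  assumes "\<phi> \<in> L1m m"
  shows "weighted_norm (\<lambda>x. norm x ^ m) \<phi> < \<infinity>"
proof -
  have \<phi> [measurable]: "\<phi> \<in> borel_measurable borel" using assms by (auto simp: L1m_def Lp_def)
  \<comment> \<open>All of the order is put on coordinate \<open>i\<close>, so that the monomial is
    the pure power \<open>(x $ i) ^ m\<close>; by \<open>norm_power_le_sum_component_power\<close>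
    these n monomials control the full moment.\<close>
  define e where "e i = (\<lambda>j::'n. if j = i then m else 0)" for i
  have e: "mi_order (e i) = m" for i by (simp add: mi_order_def e_def)
  have "\<bar>x $ i\<bar> ^ m = \<bar>\<Prod>j\<in>UNIV. (x $ j) ^ e i j\<bar>" for x :: "real ^ 'n" and i
  proof -
    have "(\<Prod>j\<in>UNIV. (x $ j) ^ e i j) = (\<Prod>j\<in>UNIV. if j = i then (x $ j) ^ m else 1)"
      by (intro prod.cong) (auto simp: e_def)
    then show ?thesis by (simp add: power_abs)
  qed
  then have W: "weighted_norm (\<lambda>x. \<bar>x $ i\<bar> ^ m) \<phi> < \<infinity>" for i
    using assms e[of i] by (auto simp: L1m_def Lp_def Lp_norm_1_mi_mult)
  have "weighted_norm (\<lambda>x. norm x ^ m) \<phi> \<le> weighted_norm (\<lambda>x. real CARD('n) ^ m * (\<Sum>i\<in>UNIV. \<bar>x $ i\<bar> ^ m)) \<phi>"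
    by (intro weighted_norm_mono norm_power_le_sum_component_power)
  also have "\<dots> = (\<integral>\<^sup>+x. (\<Sum>i\<in>UNIV. ennreal (real CARD('n) ^ m) * ennreal (\<bar>x $ i\<bar> ^ m * norm (\<phi> x))) \<partial>lborel)"
    unfolding weighted_norm_def
    by (intro nn_integral_cong) (simp add: sum_ennreal sum_distrib_left sum_distrib_right mult_ac flip: ennreal_mult)
  also have "\<dots> = (\<Sum>i\<in>UNIV. ennreal (real CARD('n) ^ m) * weighted_norm (\<lambda>x. \<bar>x $ i\<bar> ^ m) \<phi>)"
    unfolding weighted_norm_def by (simp add: nn_integral_sum nn_integral_cmult)
  also have "\<dots> < \<infinity>" using W by (auto simp: ennreal_mult_less_top)
  finally show ?thesis .
qed

section \<open>Integrable decay of the nonlinearity along the solution\<close>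

text \<open>Taking \<eta> = 0 in the Lipschitz condition gives |f(\<xi>)| \<le> K |\<xi>|^p; the
  power p - 1 is estimated by the sup norm of \<open>u s\<close> and one factor is kept. Small times
  are covered by the bound contained in the solution space, large times by the decay with constant
  \<open>S\<close>. The former is an essential bound in time, whence the outer almost-everywhere
  quantifier.\<close>

lemma nonlinearity_decay_bound:
  fixes u :: "real \<Rightarrow> real ^ 'n::finite \<Rightarrow> complex"
  assumes p: "1 < p" and K: "0 < K" and f0: "f 0 = 0"
    and f: "\<And>\<xi> \<eta>. norm (f \<xi> - f \<eta>) \<le> K * (norm \<xi> powr (p - 1) + norm \<eta> powr (p - 1)) * norm (\<xi> - \<eta>)"
    and u: "u \<in> bdd_cont_into {0<..} (Lp \<infinity>) (Lp_norm \<infinity>)"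
    and S: "0 \<le> S" "\<And>t. 0 < t \<Longrightarrow> ennreal (t powr (real CARD('n) / 2)) * Lp_norm \<infinity> (u t) \<le> ennreal S"
  obtains A where "0 \<le> A"
    "AE s in lborel. 0 < s \<longrightarrow> (AE x in lborel. norm (f (u s x))
        \<le> A * (1 + s) powr (- (real CARD('n) / 2 * (p - 1))) * norm (u s x))"
proof -
  define q where "q = real CARD('n) / 2"
  have q: "0 < q" by (simp add: q_def)
  define Z where "Z = esssup (restrict_space lborel {0<..}) (\<lambda>t. Lp_norm \<infinity> (u t))"
  have Z: "Z < \<infinity>" using u by (simp add: bdd_cont_into_def Z_def)
  have "AE t in restrict_space lborel {0<..}. Lp_norm \<infinity> (u t) \<le> Z"
    unfolding Z_def by (rule esssup_AE)
  then have AEt: "AE t in lborel. 0 < t \<longrightarrow> Lp_norm \<infinity> (u t) \<le> Z"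
    by (subst (asm) AE_restrict_space_iff) auto
  \<comment> \<open>The factor \<open>2 powr q\<close> turns both bounds into multiples of
    \<open>(1 + t) powr (- q)\<close>: by 1 + t \<le> 2 when t \<le> 1, and by 1 + t \<le> 2 t
    otherwise.\<close>
  define D where "D = 2 powr q * (enn2real Z + S)"
  have D: "0 \<le> D" using S by (simp add: D_def)
  have uD: "norm (u t x) \<le> D * (1 + t) powr (- q)"
    if t: "0 < t" and tZ: "Lp_norm \<infinity> (u t) \<le> Z" and x: "ennreal (norm (u t x)) \<le> Lp_norm \<infinity> (u t)" for t x
  proof (cases "t \<le> 1")
    case True
    have "ennreal (norm (u t x)) \<le> ennreal (enn2real Z)"
      using x tZ Z by (simp add: less_top)
    then have "norm (u t x) \<le> enn2real Z" by simp
    also have "\<dots> \<le> enn2real Z * (2 powr q * (1 + t) powr (- q))"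
    proof -
      have "2 powr (- q) \<le> (1 + t) powr (- q)" using True t q by (intro powr_mono2') auto
      then have "1 \<le> 2 powr q * (1 + t) powr (- q)" by (simp add: powr_minus field_simps)
      then show ?thesis using mult_left_mono[of 1 _ "enn2real Z"] by fastforce
    qed
    also have "\<dots> \<le> D * (1 + t) powr (- q)" using S by (simp add: D_def algebra_simps)
    finally show ?thesis .
  next
    case False
    have "ennreal (t powr q) * ennreal (norm (u t x)) \<le> ennreal (t powr q) * Lp_norm \<infinity> (u t)"
      using x by (intro mult_left_mono) auto
    also have "\<dots> \<le> ennreal S" using S(2)[OF t] by (simp add: q_def)
    finally have "t powr q * norm (u t x) \<le> S" using S(1) by (simp flip: ennreal_mult)
    then have "norm (u t x) \<le> S * t powr (- q)" using t by (simp add: powr_minus field_simps)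
    also have "\<dots> \<le> S * (2 powr q * (1 + t) powr (- q))"
    proof -
      have "(1 + t) powr q \<le> (2 * t) powr q" using False q by (intro powr_mono2) auto
      then have "t powr (- q) \<le> 2 powr q * (1 + t) powr (- q)"
        using t by (simp add: powr_minus powr_mult field_simps)
      then show ?thesis using S by (intro mult_left_mono) auto
    qed
    also have "\<dots> \<le> D * (1 + t) powr (- q)" by (simp add: D_def algebra_simps)
    finally show ?thesis .
  qed
  show ?thesis
  proof (rule that[of "K * D powr (p - 1)"])
    show "0 \<le> K * D powr (p - 1)" using K by simp
    show "AE s in lborel. 0 < s \<longrightarrow> (AE x in lborel. norm (f (u s x))
        \<le> K * D powr (p - 1) * (1 + s) powr (- (real CARD('n) / 2 * (p - 1))) * norm (u s x))"
      using AEt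
    proof eventually_elim
      case (elim s)
      show ?case
      proof
        assume s: "0 < s"
        have "AE x in lborel. ennreal (norm (u s x)) \<le> Lp_norm \<infinity> (u s)"
          by (simp add: Lp_norm_def esssup_AE)
        then show "AE x in lborel. norm (f (u s x))
          \<le> K * D powr (p - 1) * (1 + s) powr (- (real CARD('n) / 2 * (p - 1))) * norm (u s x)"
        proof eventually_elim
          case x: (elim x)
          have "norm (f (u s x)) \<le> K * norm (u s x) powr (p - 1) * norm (u s x)"
            using f[of "u s x" 0] p by (simp add: f0)
          also have "\<dots> \<le> K * (D * (1 + s) powr (- q)) powr (p - 1) * norm (u s x)"
            using K p elim s x uD[of s x] by (intro mult_right_mono mult_left_mono powr_mono2) auto
          also have "(D * (1 + s) powr (- q)) powr (p - 1) = D powr (p - 1) * (1 + s) powr (- (q * (p - 1)))"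
            using D by (simp add: powr_mult powr_powr)
          finally show ?case by (simp add: q_def mult_ac)
        qed
      qed
    qed
  qed
qed

text \<open>The bound is the integral over the whole half-line; \<gamma> > 1 makes the primitive
  \<open>F\<close> nonpositive.\<close>

lemma integral_powr_decay_le:
  fixes A \<gamma> t :: real
  assumes "0 \<le> A" "1 < \<gamma>" "0 \<le> t"
  shows "integral {0..t} (\<lambda>s. A * (1 + s) powr (- \<gamma>)) \<le> A / (\<gamma> - 1)"
proof -
  define F where "F s = - (A / (\<gamma> - 1)) * (1 + s) powr (1 - \<gamma>)" for s
  have "((\<lambda>s. A * (1 + s) powr (- \<gamma>)) has_integral (F t - F 0)) {0..t}"
  proof (rule fundamental_theorem_of_calculus)
    fix s assume "s \<in> {0..t}"
    then have "(F has_real_derivative - (A / (\<gamma> - 1)) * ((1 - \<gamma>) * (1 + s) powr (- \<gamma>))) (at s within {0..t})"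
      unfolding F_def using assms by (auto intro!: derivative_eq_intros)
    also have "- (A / (\<gamma> - 1)) * ((1 - \<gamma>) * (1 + s) powr (- \<gamma>)) = A * (1 + s) powr (- \<gamma>)"
      using assms by (simp add: divide_simps) (simp add: algebra_simps)
    finally have "(F has_real_derivative A * (1 + s) powr (- \<gamma>)) (at s within {0..t})" .
    then show "(F has_vector_derivative A * (1 + s) powr (- \<gamma>)) (at s within {0..t})"
      by (simp add: has_real_derivative_iff_has_vector_derivative)
  qed (use assms in auto)
  then have "integral {0..t} (\<lambda>s. A * (1 + s) powr (- \<gamma>)) = F t - F 0" by (rule integral_unique)
  also have "\<dots> \<le> A / (\<gamma> - 1)" using assms by (simp add: F_def)
  finally show ?thesis .
qed

text \<open>Supplies the Borel measurability of \<open>f\<close>. For fixed \<eta> the bound tends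
  to 0 as \<xi> tends to \<eta>, also at \<eta> = 0 because p - 1 > 0.\<close>

lemma continuous_on_of_local_Lipschitz_powr:
  fixes f :: "complex \<Rightarrow> complex"
  assumes p: "1 < p"
    and f: "\<And>\<xi> \<eta>. norm (f \<xi> - f \<eta>) \<le> K * (norm \<xi> powr (p - 1) + norm \<eta> powr (p - 1)) * norm (\<xi> - \<eta>)"
  shows "continuous_on UNIV f"
  unfolding continuous_on_def
proof
  fix \<eta> :: complex
  have "((\<lambda>\<xi>. K * (norm \<xi> powr (p - 1) + norm \<eta> powr (p - 1)) * norm (\<xi> - \<eta>)) \<longlongrightarrow>
      K * (norm \<eta> powr (p - 1) + norm \<eta> powr (p - 1)) * norm (\<eta> - \<eta>)) (at \<eta>)"
    using p by (intro tendsto_intros tendsto_powr') auto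
  then have lim: "((\<lambda>\<xi>. K * (norm \<xi> powr (p - 1) + norm \<eta> powr (p - 1)) * norm (\<xi> - \<eta>)) \<longlongrightarrow> 0) (at \<eta>)"
    by simp
  have "((\<lambda>\<xi>. f \<xi> - f \<eta>) \<longlongrightarrow> 0) (at \<eta>)"
    by (rule Lim_null_comparison[OF _ lim], rule always_eventually, rule allI, rule f)
  then show "(f \<longlongrightarrow> f \<eta>) (at \<eta> within UNIV)" by (rule LIM_zero_cancel)
qed

text \<open>Rests on \<open>norm x \<le> R + excess R x\<close>. The factor of the L1 norm may grow
  with \<open>R\<close> while that of the tail does not, which is what the proof of continuity
  exploits.\<close>

lemma weighted_norm_one_add_power_le:
  fixes \<phi> :: "'n::finite cfun"
  assumes [measurable]: "\<phi> \<in> borel_measurable borel" and R: "0 \<le> R"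
  shows "weighted_norm (\<lambda>x. 1 + norm x ^ m) \<phi>
    \<le> ennreal (1 + 2 ^ m * R ^ m) * Lp_norm 1 \<phi> + ennreal (2 ^ m) * weighted_norm (\<lambda>x. excess R x ^ m) \<phi>"
proof -
  have "1 + norm x ^ m \<le> (1 + 2 ^ m * R ^ m) * 1 + 2 ^ m * excess R x ^ m" for x :: "real ^ 'n"
  proof -
    have "norm x ^ m \<le> (R + excess R x) ^ m" by (intro power_mono) (auto simp: excess_def)
    also have "\<dots> \<le> 2 ^ m * (R ^ m + excess R x ^ m)" using R by (intro power_add_le) auto
    finally show ?thesis by (simp add: algebra_simps)
  qed
  then have "weighted_norm (\<lambda>x. 1 + norm x ^ m) \<phi> \<le> weighted_norm (\<lambda>x. (1 + 2 ^ m * R ^ m) * 1 + 2 ^ m * excess R x ^ m) \<phi>"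
    by (rule weighted_norm_mono)
  also have "\<dots> = ennreal (1 + 2 ^ m * R ^ m) * Lp_norm 1 \<phi> + ennreal (2 ^ m) * weighted_norm (\<lambda>x. excess R x ^ m) \<phi>"
    unfolding Lp_norm_1_eq_weighted_norm using R by (intro weighted_norm_add_cmult) auto
  finally show ?thesis .
qed

section \<open>Moments, tails and continuity under an integrable bound on the nonlinearity\<close>

text \<open>The nonlinearity is reduced to the linear bound \<open>fa\<close>, whose coefficient has
  bounded integrals; the exponent p and the Lipschitz constant no longer appear. The bounds in
  \<open>M\<close> treat \<open>u\<^sub>0\<close> and positive times separately because
  \<open>u 0\<close> is not identified with \<open>u\<^sub>0\<close>.\<close>

locale decaying_mild_solution =
  fixes \<nu> :: complex and f :: "complex \<Rightarrow> complex" and m :: nat and a :: "real \<Rightarrow> real" and J M :: real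
    and u\<^sub>0 :: "real ^ 'n::finite \<Rightarrow> complex" and u :: "real \<Rightarrow> real ^ 'n \<Rightarrow> complex"
  assumes \<nu>: "0 < Re \<nu>"
    and m: "0 < m"
    and u0: "u\<^sub>0 \<in> L1m m"
    and sol: "global_mild_solution \<nu> f u\<^sub>0 u"
    and f [measurable]: "f \<in> borel_measurable borel"
    and a: "continuous_on {0..} a" "\<And>s. 0 \<le> a s" "\<And>t. 0 \<le> t \<Longrightarrow> integral {0..t} a \<le> J"
    and fa: "AE s in lborel. 0 < s \<longrightarrow> (AE x in lborel. norm (f (u s x)) \<le> a s * norm (u s x))"
    and M: "0 \<le> M" "Lp_norm 1 u\<^sub>0 \<le> ennreal M" "\<And>t. 0 < t \<Longrightarrow> Lp_norm 1 (u t) \<le> ennreal M"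
begin

lemma u0_measurable [measurable]: "u\<^sub>0 \<in> borel_measurable borel"
  using u0 by (auto simp: L1m_def Lp_def)

lemma u_cont: "u \<in> cont_into {0..} (Lp 1) (Lp_norm 1)"
  using sol by (auto simp: global_mild_solution_def solution_space_def bdd_cont_into_def)

lemma u_measurable: "0 \<le> t \<Longrightarrow> u t \<in> borel_measurable borel"
  using u_cont by (auto simp: cont_into_def Lp_def)

text \<open>For R = 0 the error weight is the constant \<open>C * sqrt T ^ m\<close>, which the
  uniform L1 bound controls; this is the source of the growth in \<open>T\<close>. Keeping
  \<open>T\<close> apart from \<open>t\<close> permits both T = t, for the growth rate, and a fixed
  \<open>T\<close>, for bounds uniform on [0, T].\<close>

lemma moment_growth:
  obtains c where "0 \<le> c" "\<And>T t. 0 < T \<Longrightarrow> 0 \<le> t \<Longrightarrow> t \<le> T \<Longrightarrow>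
     weighted_norm (\<lambda>x. norm x ^ m) (u t) \<le> ennreal (c * (1 + sqrt T ^ m))"
proof -
  obtain k where k1: "1 \<le> k" and
    k: "\<And>\<tau> w (y :: real ^ 'n) a\<^sub>0 a\<^sub>1 a\<^sub>2.
       \<lbrakk>0 < \<tau>; 0 \<le> a\<^sub>0; 0 \<le> a\<^sub>1; 0 \<le> a\<^sub>2;
        \<And>x. w x \<le> a\<^sub>0 + a\<^sub>1 * norm (x - y) ^ m + a\<^sub>2 * norm (x - y) ^ Suc m\<rbrakk>
       \<Longrightarrow> (\<integral>\<^sup>+x. ennreal (w x * norm (heat_kernel \<nu> \<tau> (x - y))) \<partial>lborel)
           \<le> ennreal (k * (a\<^sub>0 + a\<^sub>1 * sqrt \<tau> ^ m + a\<^sub>2 * sqrt \<tau> ^ Suc m))"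
    using heat_kernel_weight_le[OF \<nu>] by blast
  define C where "C = k * 2 ^ m"
  have C: "1 \<le> C" unfolding C_def using mult_mono[OF k1 one_le_power[of "2::real" m]] k1 by simp
  define Q where "Q = enn2real (weighted_norm (\<lambda>x. norm x ^ m) u\<^sub>0)"
  have Q: "0 \<le> Q" "weighted_norm (\<lambda>x. norm x ^ m) u\<^sub>0 = ennreal Q"
    using weighted_norm_finite_L1m[OF u0] by (auto simp: Q_def less_top)
  \<comment> \<open>This is the bound proved below evaluated at \<open>r = 1\<close>. That bound is
    affine in \<open>r\<close> with nonnegative coefficients, hence at most
    \<open>c * (1 + r)\<close>.\<close>
  define c where "c = (C * (C * Q + C * M) + C * M) * exp (C * J)"
  have c: "0 \<le> c" unfolding c_def using C Q(1) M(1) by simp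
  show ?thesis
  proof (rule that[OF c])
    fix T t :: real assume T: "0 < T" and t: "0 \<le> t" "t \<le> T"
    define r where "r = sqrt T ^ m"
    have r: "0 \<le> r" using T by (simp add: r_def)
    define B where "B = C * r * M"
    have B: "0 \<le> B" using C r M(1) by (simp add: B_def)
    have "weighted_norm (\<lambda>x. excess 0 x ^ m) (u t) \<le> ennreal ((C * (C * Q + B) + B) * exp (C * J))"
    proof (rule weighted_norm_excess_le[OF u_measurable[OF t(1)]])
      fix L :: nat
      define w where "w x = cutoff_excess 0 (real L) x ^ m" for x :: "real ^ 'n"
      have w: "w \<in> borel_measurable borel" "\<And>x. 0 \<le> w x" "\<And>x. w x \<le> real L ^ m"
        unfolding w_def by (auto intro!: power_mono zero_le_power cutoff_excess_nonneg cutoff_excess_le)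
      have ker: "(\<integral>\<^sup>+x. ennreal (w x * norm (heat_kernel \<nu> \<tau> (x - y))) \<partial>lborel) \<le> ennreal (C * w y + C * r)"
        if \<tau>: "0 < \<tau>" "\<tau> \<le> T" for \<tau> y
      proof -
        have "(\<integral>\<^sup>+x. ennreal (w x * norm (heat_kernel \<nu> \<tau> (x - y))) \<partial>lborel)
          \<le> ennreal (k * (2 ^ m * w y + 2 ^ m * sqrt \<tau> ^ m + 0 * sqrt \<tau> ^ Suc m))"
        proof (intro k \<tau>)
          fix x
          have "w x \<le> 2 ^ m * (norm (x - y) ^ m + w y)"
            unfolding w_def by (intro cutoff_excess_power_le) auto
          then show "w x \<le> 2 ^ m * w y + 2 ^ m * norm (x - y) ^ m + 0 * norm (x - y) ^ Suc m"
            by (simp add: distrib_left)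
        qed (use w(2)[of y] in auto)
        also have "k * (2 ^ m * w y + 2 ^ m * sqrt \<tau> ^ m + 0 * sqrt \<tau> ^ Suc m) = C * (w y + sqrt \<tau> ^ m)"
          by (simp add: C_def algebra_simps)
        also have "ennreal \<dots> \<le> ennreal (C * (w y + r))"
          using \<tau> C unfolding r_def by (intro ennreal_leI mult_left_mono add_left_mono power_mono) auto
        finally show ?thesis by (simp add: algebra_simps)
      qed
      have \<beta>: "weighted_norm (\<lambda>x. C * r) \<phi> \<le> ennreal B"
        if "Lp_norm 1 \<phi> \<le> ennreal M" "\<phi> \<in> borel_measurable borel" for \<phi> :: "'n cfun"
      proof -
        have "weighted_norm (\<lambda>x. C * r) \<phi> \<le> ennreal (C * r) * Lp_norm 1 \<phi>"
          using C r that by (intro weighted_norm_le_Lp_norm_1) auto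
        also have "\<dots> \<le> ennreal (C * r) * ennreal M" using that by (intro mult_left_mono) auto
        also have "\<dots> = ennreal B" using C r M(1) by (simp add: B_def flip: ennreal_mult)
        finally show ?thesis .
      qed
      have "weighted_norm w u\<^sub>0 \<le> ennreal Q"
        unfolding Q(2)[symmetric] w_def
        by (intro weighted_norm_mono power_mono) (auto simp: cutoff_excess_def)
      then show "weighted_norm (\<lambda>x. cutoff_excess 0 (real L) x ^ m) (u t) \<le> ennreal ((C * (C * Q + B) + B) * exp (C * J))"
        unfolding w_def[symmetric] using C r B Q T t \<beta> M(2,3) u_measurable ker
        by (intro weighted_norm_mild_solution_le[where \<beta> = "\<lambda>x. C * r", OF sol u0_measurable f a fa w]) auto
    qed
    also have "\<dots> \<le> ennreal (c * (1 + r))"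
    proof (rule ennreal_leI)
      have "(C * (C * Q + B) + B) * exp (C * J) \<le> (C * (C * (Q * (1 + r)) + C * M * (1 + r)) + C * M * (1 + r)) * exp (C * J)"
        using C r Q(1) M(1) unfolding B_def
        by (intro mult_right_mono add_mono mult_left_mono) (auto simp: algebra_simps)
      also have "\<dots> = c * (1 + r)" by (simp add: c_def algebra_simps)
      finally show "(C * (C * Q + B) + B) * exp (C * J) \<le> c * (1 + r)" .
    qed
    finally show "weighted_norm (\<lambda>x. norm x ^ m) (u t) \<le> ennreal (c * (1 + sqrt T ^ m))"
      by (simp add: r_def)
  qed
qed

text \<open>The error weight from \<open>cutoff_excess_power_le_divide\<close> carries a factor 1/R
  and grows like \<open>1 + norm y ^ m\<close>, which \<open>moment_growth\<close> controls
  uniformly on [0, T]. Both contributions therefore vanish as R tends to infinity: the tail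
  \<open>Q\<close> of the initial datum by dominated convergence, and \<open>B\<close> through
  1/R.\<close>

lemma excess_uniformly_small:
  assumes T: "0 < T"
  obtains \<epsilon> :: "nat \<Rightarrow> ennreal" where "\<epsilon> \<longlonglongrightarrow> 0"
    "\<And>k t. 0 \<le> t \<Longrightarrow> t \<le> T \<Longrightarrow> weighted_norm (\<lambda>x. excess (real (Suc k)) x ^ m) (u t) \<le> \<epsilon> k"
proof -
  obtain k where k1: "1 \<le> k" and
    k: "\<And>\<tau> w (y :: real ^ 'n) a\<^sub>0 a\<^sub>1 a\<^sub>2.
       \<lbrakk>0 < \<tau>; 0 \<le> a\<^sub>0; 0 \<le> a\<^sub>1; 0 \<le> a\<^sub>2;
        \<And>x. w x \<le> a\<^sub>0 + a\<^sub>1 * norm (x - y) ^ m + a\<^sub>2 * norm (x - y) ^ Suc m\<rbrakk>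
       \<Longrightarrow> (\<integral>\<^sup>+x. ennreal (w x * norm (heat_kernel \<nu> \<tau> (x - y))) \<partial>lborel)
           \<le> ennreal (k * (a\<^sub>0 + a\<^sub>1 * sqrt \<tau> ^ m + a\<^sub>2 * sqrt \<tau> ^ Suc m))"
    using heat_kernel_weight_le[OF \<nu>] by blast
  obtain c where c: "0 \<le> c" "\<And>T t. 0 < T \<Longrightarrow> 0 \<le> t \<Longrightarrow> t \<le> T \<Longrightarrow>
     weighted_norm (\<lambda>x. norm x ^ m) (u t) \<le> ennreal (c * (1 + sqrt T ^ m))"
    using moment_growth by blast
  define C where "C = k * 2 ^ m"
  have C: "1 \<le> C" unfolding C_def using mult_mono[OF k1 one_le_power[of "2::real" m]] k1 by simp
  define \<theta> where "\<theta> = sqrt T ^ m + sqrt T ^ Suc m"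
  have \<theta>: "0 \<le> \<theta>" using T by (simp add: \<theta>_def)
  define P where "P = enn2real (weighted_norm (\<lambda>x. norm x ^ m) u\<^sub>0)"
  have P: "0 \<le> P" "weighted_norm (\<lambda>x. norm x ^ m) u\<^sub>0 = ennreal P"
    using weighted_norm_finite_L1m[OF u0] by (auto simp: P_def less_top)
  \<comment> \<open>Bounds the norm with weight \<open>1 + norm x ^ m\<close> for
    \<open>u\<^sub>0\<close> and for all \<open>u s\<close> with 0 < s \<le> T at once, hence the
    sum of \<open>P\<close> and the moment bound.\<close>
  define V where "V = M + (P + c * (1 + sqrt T ^ m))"
  have V: "0 \<le> V" unfolding V_def using M(1) P(1) c(1) T by simp
  \<comment> \<open>The radii start at 1 because they occur as divisors.\<close>
  define R where "R i = real (Suc i)" for i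
  have R: "0 < R i" for i by (simp add: R_def)
  define Q where "Q i = enn2real (weighted_norm (\<lambda>x. excess (R i) x ^ m) u\<^sub>0)" for i
  have excess_le: "weighted_norm (\<lambda>x. excess (R i) x ^ m) u\<^sub>0 \<le> ennreal P" for i
    unfolding P(2)[symmetric] using R[of i]
    by (intro weighted_norm_mono power_mono) (auto simp: excess_def)
  have Q: "0 \<le> Q i" "weighted_norm (\<lambda>x. excess (R i) x ^ m) u\<^sub>0 = ennreal (Q i)" for i
    using le_less_trans[OF excess_le[of i] ennreal_less_top] by (auto simp: Q_def)
  have "(\<lambda>i. ennreal (Q i)) \<longlonglongrightarrow> ennreal 0"
    using weighted_norm_excess_tendsto_0[OF u0_measurable m weighted_norm_finite_L1m[OF u0]]
    by (simp only: Q(2)[symmetric] R_def ennreal_0)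
  then have Q0: "Q \<longlonglongrightarrow> 0" using Q(1) by (subst (asm) tendsto_ennreal_iff) auto
  define B where "B i = C * \<theta> / R i * V" for i
  have B: "0 \<le> B i" for i using C \<theta> V R[of i] by (simp add: B_def)
  have B0: "B \<longlonglongrightarrow> 0"
    unfolding B_def R_def
    by (intro tendsto_mult_left_zero tendsto_divide_0[OF tendsto_const] filterlim_at_top_imp_at_infinity
        filterlim_compose[OF filterlim_real_sequentially] filterlim_Suc)
  define e where "e i = (C * (C * Q i + B i) + B i) * exp (C * J)" for i
  have "e \<longlonglongrightarrow> (C * (C * 0 + 0) + 0) * exp (C * J)"
    unfolding e_def by (intro tendsto_intros Q0 B0)
  then have "(\<lambda>i. ennreal (e i)) \<longlonglongrightarrow> ennreal 0" by (intro tendsto_ennrealI) simp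
  then have e0: "(\<lambda>i. ennreal (e i)) \<longlonglongrightarrow> 0" by simp
  show ?thesis
  proof (rule that[OF e0])
    fix i :: nat and t :: real assume t: "0 \<le> t" "t \<le> T"
    show "weighted_norm (\<lambda>x. excess (real (Suc i)) x ^ m) (u t) \<le> ennreal (e i)"
      unfolding R_def[symmetric]
    proof (rule weighted_norm_excess_le[OF u_measurable[OF t(1)]])
      fix L :: nat
      define w where "w x = cutoff_excess (R i) (real L) x ^ m" for x :: "real ^ 'n"
      define b where "b = C * \<theta> / R i"
      have b: "0 \<le> b" using C \<theta> R[of i] by (simp add: b_def)
      define \<beta> where "\<beta> y = b * 1 + b * norm y ^ m" for y :: "real ^ 'n"
      have w: "w \<in> borel_measurable borel" "\<And>x. 0 \<le> w x" "\<And>x. w x \<le> real L ^ m"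
        unfolding w_def by (auto intro!: power_mono zero_le_power cutoff_excess_nonneg cutoff_excess_le)
      have ker: "(\<integral>\<^sup>+x. ennreal (w x * norm (heat_kernel \<nu> \<tau> (x - y))) \<partial>lborel) \<le> ennreal (C * w y + \<beta> y)"
        if \<tau>: "0 < \<tau>" "\<tau> \<le> T" for \<tau> y
      proof -
        have "(\<integral>\<^sup>+x. ennreal (w x * norm (heat_kernel \<nu> \<tau> (x - y))) \<partial>lborel)
          \<le> ennreal (k * (2 ^ m * w y + (2 ^ m * norm y / R i) * sqrt \<tau> ^ m + (2 ^ m / R i) * sqrt \<tau> ^ Suc m))"
        proof (intro k \<tau>)
          fix x
          have "w x \<le> 2 ^ m * (norm (x - y) ^ m * (norm y + norm (x - y)) / R i + w y)"
            unfolding w_def by (intro cutoff_excess_power_le_divide R m) auto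
          also have "\<dots> = 2 ^ m * w y + (2 ^ m * norm y / R i) * norm (x - y) ^ m + (2 ^ m / R i) * norm (x - y) ^ Suc m"
            using R[of i] by (simp add: field_simps)
          finally show "w x \<le> 2 ^ m * w y + (2 ^ m * norm y / R i) * norm (x - y) ^ m + (2 ^ m / R i) * norm (x - y) ^ Suc m" .
        qed (use R[of i] w(2)[of y] in auto)
        also have "k * (2 ^ m * w y + (2 ^ m * norm y / R i) * sqrt \<tau> ^ m + (2 ^ m / R i) * sqrt \<tau> ^ Suc m)
           = C * w y + C / R i * (norm y * sqrt \<tau> ^ m + 1 * sqrt \<tau> ^ Suc m)"
          using R[of i] by (simp add: C_def field_simps)
        \<comment> \<open>Both \<open>norm y\<close> and 1 are replaced by
          \<open>1 + norm y ^ m\<close>, the former using m \<ge> 1, and \<tau> by \<open>T\<close>;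
          a single error weight \<beta>, the same for all \<tau>, results.\<close>
        also have "ennreal \<dots> \<le> ennreal (C * w y + C / R i * ((1 + norm y ^ m) * sqrt T ^ m + (1 + norm y ^ m) * sqrt T ^ Suc m))"
          using \<tau> C R[of i] power_le_one_add_power[of "norm y" 1 m] m
          by (intro ennreal_leI mult_left_mono add_mono mult_mono power_mono order_refl) auto
        also have "C * w y + C / R i * ((1 + norm y ^ m) * sqrt T ^ m + (1 + norm y ^ m) * sqrt T ^ Suc m) = C * w y + \<beta> y"
          unfolding \<beta>_def b_def \<theta>_def by (simp add: algebra_simps add_divide_distrib)
        finally show ?thesis .
      qed
      have \<beta>m: "\<beta> \<in> borel_measurable borel" "\<And>y. 0 \<le> \<beta> y" unfolding \<beta>_def using b by auto
      have \<beta>: "weighted_norm \<beta> \<phi> \<le> ennreal (B i)"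
        if "Lp_norm 1 \<phi> \<le> ennreal M" "weighted_norm (\<lambda>x. norm x ^ m) \<phi> \<le> ennreal (P + c * (1 + sqrt T ^ m))"
          "\<phi> \<in> borel_measurable borel" for \<phi> :: "'n cfun"
      proof -
        have "weighted_norm \<beta> \<phi> = ennreal b * Lp_norm 1 \<phi> + ennreal b * weighted_norm (\<lambda>x. norm x ^ m) \<phi>"
          unfolding \<beta>_def Lp_norm_1_eq_weighted_norm using that b by (intro weighted_norm_add_cmult) auto
        also have "\<dots> \<le> ennreal b * ennreal M + ennreal b * ennreal (P + c * (1 + sqrt T ^ m))"
          using that by (intro add_mono mult_left_mono) auto
        also have "\<dots> = ennreal (b * V)"
          using b M(1) P(1) c(1) T by (simp add: V_def algebra_simps flip: ennreal_mult ennreal_plus)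
        finally show ?thesis by (simp add: B_def b_def)
      qed
      have \<beta>u0: "weighted_norm \<beta> u\<^sub>0 \<le> ennreal (B i)"
        using M(2) c(1) T P by (intro \<beta>) (auto intro!: ennreal_leI)
      have \<beta>u: "weighted_norm \<beta> (u s) \<le> ennreal (B i)" if "0 < s" "s \<le> T" for s
        using M(3)[of s] c(2)[OF T, of s] that P(1) u_measurable[of s]
        by (intro \<beta>) (auto intro: order_trans intro!: ennreal_leI)
      have "weighted_norm w u\<^sub>0 \<le> ennreal (Q i)"
        unfolding Q(2)[symmetric] w_def
        by (intro weighted_norm_mono power_mono) (auto simp: cutoff_excess_def excess_def)
      then show "weighted_norm (\<lambda>x. cutoff_excess (R i) (real L) x ^ m) (u t) \<le> ennreal (e i)"
        unfolding w_def[symmetric] e_def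
        by (intro weighted_norm_mild_solution_le[OF sol u0_measurable f a fa w \<beta>m C ker B \<beta>u0 \<beta>u Q(1) _ T t])
    qed
  qed
qed

lemma solution_in_L1m:
  assumes t: "0 \<le> t"
  shows "u t \<in> L1m m"
proof -
  have ut [measurable]: "u t \<in> borel_measurable borel" using u_measurable t .
  have u1: "u t \<in> Lp 1" using u_cont t by (auto simp: cont_into_def)
  obtain c where c: "0 \<le> c" "\<And>T t. 0 < T \<Longrightarrow> 0 \<le> t \<Longrightarrow> t \<le> T \<Longrightarrow>
     weighted_norm (\<lambda>x. norm x ^ m) (u t) \<le> ennreal (c * (1 + sqrt T ^ m))"
    using moment_growth by blast
  \<comment> \<open>Choosing T = t + 1 below keeps \<open>T\<close> positive when t = 0.\<close>
  have "weighted_norm (\<lambda>x. norm x ^ m) (u t) < \<infinity>"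
    using c(2)[of "t + 1" t] t by (auto simp: less_top[symmetric] top_unique)
  then have "weighted_norm (\<lambda>x. 1 + norm x ^ m) (u t) < \<infinity>"
    using u1 weighted_norm_add_cmult[of "\<lambda>x. 1" "\<lambda>x. norm x ^ m" "u t" 1 1]
    by (simp add: Lp_norm_1_eq_weighted_norm[symmetric] Lp_def)
  then have "Lp_norm 1 (mi_mult \<alpha> (u t)) < \<infinity>" if "mi_order \<alpha> \<le> m" for \<alpha>
    using Lp_norm_1_mi_mult_le[OF that, of "u t"] by (rule le_less_trans[rotated])
  then show ?thesis using u1 by (auto simp: L1m_def Lp_def)
qed

text \<open>The norm of the difference is controlled by \<open>K k * d s\<close> plus tails of size
  \<open>\<epsilon> k\<close>. First \<open>k\<close> is chosen to make the tails small; then s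
  tends to t with \<open>K k\<close> fixed, and continuity in L1 removes the other term.\<close>

lemma solution_continuous_L1m:
  assumes t: "0 \<le> t"
  shows "((\<lambda>s. L1m_norm m (\<lambda>x. u s x - u t x)) \<longlongrightarrow> 0) (at t within {0..})"
proof -
  define N where "N = card {\<alpha> :: 'n \<Rightarrow> nat. mi_order \<alpha> \<le> m}"
  \<comment> \<open>A margin beyond \<open>t\<close>, so that the tail estimate holds at all
    nonnegative s within distance 1 of \<open>t\<close>.\<close>
  define T where "T = t + 1"
  have T: "0 < T" "t \<le> T" using t by (auto simp: T_def)
  obtain \<epsilon> where \<epsilon>0: "\<epsilon> \<longlonglongrightarrow> 0" and \<epsilon>:
    "\<And>k t. 0 \<le> t \<Longrightarrow> t \<le> T \<Longrightarrow> weighted_norm (\<lambda>x. excess (real (Suc k)) x ^ m) (u t) \<le> \<epsilon> k"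
    using excess_uniformly_small[OF T(1)] by blast
  define d where "d s = Lp_norm 1 (\<lambda>x. u s x - u t x)" for s
  have d0: "(d \<longlongrightarrow> 0) (at t within {0..})"
    using u_cont t by (auto simp: cont_into_def d_def[abs_def])
  define K where "K k = 1 + 2 ^ m * real (Suc k) ^ m" for k
  define b where "b k s = of_nat N * (ennreal (K k) * d s + ennreal (2 ^ m) * (\<epsilon> k + \<epsilon> k))" for k s
  have le: "L1m_norm m (\<lambda>x. u s x - u t x) \<le> b k s" if s: "0 \<le> s" "s \<le> T" for k s
  proof -
    have [measurable]: "u s \<in> borel_measurable borel" "u t \<in> borel_measurable borel"
      using u_measurable s t by auto
    have "weighted_norm (\<lambda>x. excess (real (Suc k)) x ^ m) (\<lambda>x. u s x - u t x)
       \<le> weighted_norm (\<lambda>x. excess (real (Suc k)) x ^ m) (u s) + weighted_norm (\<lambda>x. excess (real (Suc k)) x ^ m) (u t)"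
      by (intro weighted_norm_triangle norm_triangle_ineq4) auto
    also have "\<dots> \<le> \<epsilon> k + \<epsilon> k" using s t T by (intro add_mono \<epsilon>) auto
    finally have 1: "weighted_norm (\<lambda>x. excess (real (Suc k)) x ^ m) (\<lambda>x. u s x - u t x) \<le> \<epsilon> k + \<epsilon> k" .
    have "weighted_norm (\<lambda>x. 1 + norm x ^ m) (\<lambda>x. u s x - u t x)
      \<le> ennreal (K k) * d s + ennreal (2 ^ m) * weighted_norm (\<lambda>x. excess (real (Suc k)) x ^ m) (\<lambda>x. u s x - u t x)"
      unfolding K_def d_def by (intro weighted_norm_one_add_power_le) auto
    also have "\<dots> \<le> ennreal (K k) * d s + ennreal (2 ^ m) * (\<epsilon> k + \<epsilon> k)"
      by (intro add_left_mono mult_left_mono 1) auto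
    finally have 2: "weighted_norm (\<lambda>x. 1 + norm x ^ m) (\<lambda>x. u s x - u t x)
      \<le> ennreal (K k) * d s + ennreal (2 ^ m) * (\<epsilon> k + \<epsilon> k)" .
    show ?thesis unfolding L1m_norm_def b_def N_def
      by (intro sum_bounded_above order_trans[OF Lp_norm_1_mi_mult_le 2]) auto
  qed
  show ?thesis
  proof (rule order_tendstoI)
    fix e :: ennreal assume e: "0 < e"
    have "(\<lambda>k. of_nat N * (ennreal (2 ^ m) * (\<epsilon> k + \<epsilon> k))) \<longlonglongrightarrow> of_nat N * (ennreal (2 ^ m) * (0 + 0))"
      by (intro ennreal_tendsto_cmult tendsto_add \<epsilon>0) (auto simp: of_nat_less_top)
    then have "\<forall>\<^sub>F k in sequentially. of_nat N * (ennreal (2 ^ m) * (\<epsilon> k + \<epsilon> k)) < e"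
      using e by (intro order_tendstoD(2)) auto
    then obtain k where k: "of_nat N * (ennreal (2 ^ m) * (\<epsilon> k + \<epsilon> k)) < e"
      by (auto simp: eventually_sequentially)
    have "(b k \<longlongrightarrow> of_nat N * (ennreal (K k) * 0 + ennreal (2 ^ m) * (\<epsilon> k + \<epsilon> k))) (at t within {0..})"
      unfolding b_def by (intro ennreal_tendsto_cmult tendsto_add tendsto_const d0) (auto simp: of_nat_less_top)
    then have "\<forall>\<^sub>F s in at t within {0..}. b k s < e"
      using k by (intro order_tendstoD(2)) auto
    moreover have "\<forall>\<^sub>F s in at t within {0..}. s \<le> T"
      unfolding eventually_at by (intro exI[of _ 1]) (auto simp: T_def dist_real_def)
    moreover have "\<forall>\<^sub>F s in at t within {0..}. 0 \<le> s" unfolding eventually_at_filter by simp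
    ultimately show "\<forall>\<^sub>F s in at t within {0..}. L1m_norm m (\<lambda>x. u s x - u t x) < e"
      by eventually_elim (use le in \<open>auto intro: le_less_trans\<close>)
  qed auto
qed

lemma moment_sum_growth:
  "\<exists>C>0. \<forall>t>0. (\<Sum>\<alpha> | mi_order \<alpha> = m. Lp_norm 1 (mi_mult \<alpha> (u t))) \<le> ennreal (C * (1 + t powr (real m / 2)))"
proof -
  obtain c where c: "0 \<le> c" "\<And>T t. 0 < T \<Longrightarrow> 0 \<le> t \<Longrightarrow> t \<le> T \<Longrightarrow>
     weighted_norm (\<lambda>x. norm x ^ m) (u t) \<le> ennreal (c * (1 + sqrt T ^ m))"
    using moment_growth by blast
  define N where "N = card {\<alpha> :: 'n \<Rightarrow> nat. mi_order \<alpha> = m}"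
  show ?thesis
  proof (intro exI conjI allI impI)
    \<comment> \<open>The summand 1 keeps the constant strictly positive even if \<open>c\<close> is
      0.\<close>
    show "0 < real N * c + 1" using c(1) by (simp add: add_nonneg_pos)
    fix t :: real assume t: "0 < t"
    have "Lp_norm 1 (mi_mult \<alpha> (u t)) \<le> ennreal (c * (1 + sqrt t ^ m))" if "mi_order \<alpha> = m" for \<alpha>
    proof -
      have "Lp_norm 1 (mi_mult \<alpha> (u t)) \<le> weighted_norm (\<lambda>x. norm x ^ m) (u t)"
        unfolding Lp_norm_1_mi_mult that[symmetric] by (intro weighted_norm_mono abs_mi_prod_le)
      \<comment> \<open>Here T = t, which turns the bound uniform on [0, T] into a growth rate in
        t.\<close>
      then show ?thesis using c(2)[of t t] t by (auto intro: order_trans)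
    qed
    then have "(\<Sum>\<alpha> | mi_order \<alpha> = m. Lp_norm 1 (mi_mult \<alpha> (u t))) \<le> of_nat N * ennreal (c * (1 + sqrt t ^ m))"
      unfolding N_def by (intro sum_bounded_above) auto
    also have "\<dots> = ennreal (real N * c * (1 + sqrt t ^ m))"
      using c(1) t by (simp add: ennreal_of_nat_eq_real_of_nat mult.assoc flip: ennreal_mult)
    also have "\<dots> \<le> ennreal ((real N * c + 1) * (1 + sqrt t ^ m))"
      using t by (intro ennreal_leI mult_right_mono) auto
    also have "sqrt t ^ m = t powr (real m / 2)"
      using t by (simp add: powr_half_sqrt[symmetric] powr_powr flip: powr_realpow)
    finally show "(\<Sum>\<alpha> | mi_order \<alpha> = m. Lp_norm 1 (mi_mult \<alpha> (u t)))
      \<le> ennreal ((real N * c + 1) * (1 + t powr (real m / 2)))" .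
  qed
qed

end

section \<open>Verification of the locale assumptions from the decay hypothesis\<close>

theorem theorem1p2:
  fixes \<nu> :: complex and p K :: real and f :: "complex \<Rightarrow> complex" and m :: nat
    and u\<^sub>0 :: "real ^ 'n::finite \<Rightarrow> complex" and u :: "real \<Rightarrow> real ^ 'n \<Rightarrow> complex"
  assumes "Re \<nu> > 0"
    and "p > 1"
    and "f 0 = 0"
    and "K > 0"
    and "\<And>\<xi> \<eta>. norm (f \<xi> - f \<eta>) \<le> K * (norm \<xi> powr (p - 1) + norm \<eta> powr (p - 1)) * norm (\<xi> - \<eta>)"
    and "p > 1 + 2 / real CARD('n)"
    and "m > 0"
    and "u\<^sub>0 \<in> L1m m \<inter> Lp \<infinity>"
    and "global_mild_solution \<nu> f u\<^sub>0 u"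
    and "(SUP q\<in>{1..}. SUP t\<in>{0<..}.
            ennreal (t powr (real CARD('n) / 2 * (1 - enn2real (1 / q)))) * Lp_norm q (u t)) < \<infinity>"
  shows "u \<in> cont_into {0..} (L1m m) (L1m_norm m) \<and>
    (\<exists>C>0. \<forall>t>0. (\<Sum>\<alpha> | mi_order \<alpha> = m. Lp_norm 1 (mi_mult \<alpha> (u t)))
        \<le> ennreal (C * (1 + t powr (real m / 2))))"
proof -
  define Z where "Z = (SUP q\<in>{1..}. SUP t\<in>{0<..}.
            ennreal (t powr (real CARD('n) / 2 * (1 - enn2real (1 / q)))) * Lp_norm q (u t))"
  define S where "S = enn2real Z"
  have S: "0 \<le> S" "Z = ennreal S" using assms(10)[folded Z_def] by (auto simp: S_def less_top)
  have sup: "ennreal (t powr (real CARD('n) / 2 * (1 - enn2real (1 / q)))) * Lp_norm q (u t) \<le> ennreal S"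
    if "1 \<le> q" "0 < t" for q t
    unfolding S(2)[symmetric] Z_def using that by (intro SUP_upper2[of q] SUP_upper2[of t]) auto
  \<comment> \<open>At q = 1 the exponent of t is 0; at q = \<infinity> the reciprocal of q is 0 and
    the exponent is n/2.\<close>
  have S1: "Lp_norm 1 (u t) \<le> ennreal S" if "0 < t" for t
    using sup[OF order_refl that] that by simp
  have Sinf: "ennreal (t powr (real CARD('n) / 2)) * Lp_norm \<infinity> (u t) \<le> ennreal S" if "0 < t" for t
    using sup[of \<infinity> t] that by simp
  define \<gamma> where "\<gamma> = real CARD('n) / 2 * (p - 1)"
  \<comment> \<open>The condition p - 1 > 2/n multiplied by n/2; it is equivalent to integrability
    of \<open>(1 + s) powr (- \<gamma>)\<close> at infinity.\<close>
  have "2 / real CARD('n) * (real CARD('n) / 2) < (p - 1) * (real CARD('n) / 2)"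
    using assms(6) by (intro mult_strict_right_mono) auto
  then have \<gamma>: "1 < \<gamma>" by (simp add: \<gamma>_def mult.commute)
  have "u \<in> bdd_cont_into {0<..} (Lp \<infinity>) (Lp_norm \<infinity>)"
    using assms(9) by (auto simp: global_mild_solution_def solution_space_def)
  then obtain A where A: "0 \<le> A" and fa:
    "AE s in lborel. 0 < s \<longrightarrow> (AE x in lborel. norm (f (u s x))
        \<le> A * (1 + s) powr (- (real CARD('n) / 2 * (p - 1))) * norm (u s x))"
    using nonlinearity_decay_bound[OF assms(2,4,3,5) _ S(1) Sinf] by blast
  \<comment> \<open>The supremum runs over positive times and does not mention
    \<open>u\<^sub>0\<close>, so the L1 norm of \<open>u\<^sub>0\<close> is added to
    \<open>S\<close> to form the common bound.\<close>
  define U where "U = enn2real (Lp_norm 1 u\<^sub>0)"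
  have U: "0 \<le> U" "Lp_norm 1 u\<^sub>0 = ennreal U"
    using assms(8) by (auto simp: U_def L1m_def Lp_def less_top)
  interpret decaying_mild_solution \<nu> f m "\<lambda>s. A * (1 + s) powr (- \<gamma>)" "A / (\<gamma> - 1)" "S + U" u\<^sub>0 u
  proof
    show "f \<in> borel_measurable borel"
      using assms(2,5) by (intro borel_measurable_continuous_onI continuous_on_of_local_Lipschitz_powr)
    show "continuous_on {0..} (\<lambda>s. A * (1 + s) powr (- \<gamma>))"
      by (intro continuous_intros) auto
    show "integral {0..t} (\<lambda>s. A * (1 + s) powr (- \<gamma>)) \<le> A / (\<gamma> - 1)" if "0 \<le> t" for t
      using A \<gamma> that by (rule integral_powr_decay_le)
    show "AE s in lborel. 0 < s \<longrightarrow> (AE x in lborel. norm (f (u s x)) \<le> A * (1 + s) powr (- \<gamma>) * norm (u s x))"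
      using fa by (simp add: \<gamma>_def)
    show "Lp_norm 1 u\<^sub>0 \<le> ennreal (S + U)" unfolding U(2) using S(1) by (intro ennreal_leI) simp
    show "Lp_norm 1 (u t) \<le> ennreal (S + U)" if "0 < t" for t
      using U(1) by (intro order_trans[OF S1[OF that] ennreal_leI]) simp
  qed (use assms A S(1) U(1) in auto)
  show ?thesis
    using solution_in_L1m solution_continuous_L1m moment_sum_growth by (auto simp: cont_into_def)
qed

end
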